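(* For every $r\ge 2$ and every fullerene nanodisc $D_r$, the central layer of $D_r$ (the subgraph consisting of the two auxiliary cycles of length $12r-6$ together with the $6r$ radial edges joining them) is $4$-total colorable.
   Context: A total coloring of a graph $G=(V,E)$ is an assignment of colors to the elements of $V\cup E$ such that adjacent vertices, adjacent edges, and incident vertex–edge pairs receive different colors; $G$ is $k$-total colorable if it has a total coloring using a set of $k$ colors. A fullerene graph is a cubic, 3-connected, planar graph all of whose faces are pentagons or hexagons (it then has exactly 12 pentagonal faces). For $r\ge 2$, a fullerene nanodisc $D_r$ of radius $r$ is a fullerene graph with a circular planar embedding whose faces are arranged into $2r+1$ concentric consecutive layers having, in order, $1,6,12,18,\ldots,6(r-1),6r,6(r-1),\ldots,18,12,6,1$ faces, where the first and last layers each consist of one hexagonal face (the covers), and all 12 pentagonal faces lie in the central layer, the unique layer with $6r$ faces (whose other $6r-12$ faces are hexagons). Consecutive layers are separated by $2r$ pairwise vertex-disjoint auxiliary cycles, whose lengths are, in order, $6,18,\ldots,12r-18,12r-6,12r-6,12r-18,\ldots,18,6$; together they contain all $12r^2$ vertices. Each layer other than the covers is the ring of faces between two consecutive auxiliary cycles. The edges of $D_r$ not on auxiliary cycles are the radial edges; each joins two consecutive auxiliary cycles, and the radial edges form a perfect matching of $D_r$. The central layer is defined by the two auxiliary cycles of length $12r-6$ and the $6r$ radial edges between them. *)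

theory Defs
  imports "Graph_Theory.Graph_Theory" "HOL-Combinatorics.Orbits"
begin

text \<open>
  A finite simple graph is a \<^locale>\<open>pair_graph\<close>: its arcs are ordered pairs, and each undirected
  edge is present as two opposite arcs.
\<close>

definition edges :: "'a pair_pre_digraph \<Rightarrow> 'a set set" where
  "edges G = (\<lambda>(u, v). {u, v}) ` parcs G"

definition total_coloring :: "'a pair_pre_digraph \<Rightarrow> ('a + 'a set \<Rightarrow> 'c) \<Rightarrow> bool" where
  "total_coloring G c \<longleftrightarrow>
     (\<forall>u v. (u, v) \<in> parcs G \<longrightarrow> c (Inl u) \<noteq> c (Inl v)) \<and>
     (\<forall>e\<in>edges G. \<forall>f\<in>edges G. e \<noteq> f \<and> e \<inter> f \<noteq> {} \<longrightarrow> c (Inr e) \<noteq> c (Inr f)) \<and>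
     (\<forall>e\<in>edges G. \<forall>v\<in>e. c (Inl v) \<noteq> c (Inr e))"

definition total_colorable :: "nat \<Rightarrow> 'a pair_pre_digraph \<Rightarrow> bool" where
  "total_colorable k G \<longleftrightarrow>
     (\<exists>c :: 'a + 'a set \<Rightarrow> nat. total_coloring G c \<and> c ` (pverts G <+> edges G) \<subseteq> {..<k})"

definition k_connected :: "nat \<Rightarrow> 'a pair_pre_digraph \<Rightarrow> bool" where
  "k_connected k G \<longleftrightarrow> k < card (pverts G) \<and>
     (\<forall>S \<subseteq> pverts G. card S < k \<longrightarrow> connected (with_proj G \<restriction> (pverts G - S)))"

text \<open>
  Embeddings are given by rotation systems: \<open>rot\<close> permutes the arcs leaving each vertex in their
  clockwise order. Then \<open>face_succ rot\<close> sends an arc to the next one on the boundary of the face to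
  its left, so each orbit of \<open>face_succ rot\<close> is the set of boundary arcs of a face, each arc having
  that face on its left. The face to the right of an arc is the left face of the opposite arc.
\<close>

definition face_succ :: "('a \<times> 'a \<Rightarrow> 'a \<times> 'a) \<Rightarrow> 'a \<times> 'a \<Rightarrow> 'a \<times> 'a" where
  "face_succ rot a = rot (prod.swap a)"

definition left_face :: "('a \<times> 'a \<Rightarrow> 'a \<times> 'a) \<Rightarrow> 'a \<times> 'a \<Rightarrow> ('a \<times> 'a) set" where
  "left_face rot a = orbit (face_succ rot) a"

definition faces :: "'a pair_pre_digraph \<Rightarrow> ('a \<times> 'a \<Rightarrow> 'a \<times> 'a) \<Rightarrow> ('a \<times> 'a) set set" where
  "faces G rot = left_face rot ` parcs G"

text \<open>
  A fullerene graph with an embedding in the plane, or equivalently the sphere. As the graph is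
  connected, Euler's formula says that the rotation system has genus 0.
\<close>

locale embedded_fullerene = pair_graph G
  for G :: "'a pair_pre_digraph" +
  fixes rot :: "'a \<times> 'a \<Rightarrow> 'a \<times> 'a"
  assumes cubic: "\<And>v. v \<in> pverts G \<Longrightarrow> out_degree (with_proj G) v = 3"
    and three_connected: "k_connected 3 G"
    and rotation: "\<And>v. v \<in> pverts G \<Longrightarrow> cyclic_on rot (out_arcs (with_proj G) v)"
    and euler: "card (pverts G) + card (faces G rot) = card (edges G) + 2"
    and face_size: "\<And>f. f \<in> faces G rot \<Longrightarrow> card f = 5 \<or> card f = 6"

definition layer_size :: "nat \<Rightarrow> nat \<Rightarrow> nat" where
  "layer_size r i = (if i = 0 \<or> i = 2 * r then 1 else 6 * min i (2 * r - i))"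

definition cycle_verts :: "('a \<times> 'a) list \<Rightarrow> 'a set" where
  "cycle_verts p = fst ` set p"

definition radial_arcs ::
  "nat \<Rightarrow> 'a pair_pre_digraph \<Rightarrow> (nat \<Rightarrow> ('a \<times> 'a) list) \<Rightarrow> ('a \<times> 'a) set" where
  "radial_arcs r G C = parcs G - (\<Union>i<2 * r. set (C i) \<union> (set (C i))\<inverse>)"

text \<open>
  The layers are numbered \<open>0, \<dots>, 2 * r\<close> and \<open>layer f\<close> is the number of the layer of the face \<open>f\<close>.
  The auxiliary cycle \<open>C i\<close> is a list of arcs, directed so that layer \<open>i\<close> is on its left and layer
  \<open>i + 1\<close> on its right. Thus for \<open>0 < i < 2 * r\<close> layer \<open>i\<close> is the ring of faces between
  \<open>C (i - 1)\<close> and \<open>C i\<close>, and the central layer is layer \<open>r\<close>.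
\<close>

locale fullerene_nanodisc = embedded_fullerene G rot
  for r :: nat and G :: "'a pair_pre_digraph" and rot :: "'a \<times> 'a \<Rightarrow> 'a \<times> 'a" +
  fixes layer :: "('a \<times> 'a) set \<Rightarrow> nat"
    and C :: "nat \<Rightarrow> ('a \<times> 'a) list"
  assumes radius: "2 \<le> r"
    and layer_le: "\<And>f. f \<in> faces G rot \<Longrightarrow> layer f \<le> 2 * r"
    and card_layer: "\<And>i. i \<le> 2 * r \<Longrightarrow> card {f \<in> faces G rot. layer f = i} = layer_size r i"
    and pentagons_central: "\<And>f. f \<in> faces G rot \<Longrightarrow> card f = 5 \<Longrightarrow> layer f = r"
    and aux_cycle: "\<And>i. i < 2 * r \<Longrightarrow> pre_digraph.cycle (with_proj G) (C i)"
    and aux_length: "\<And>i. i < 2 * r \<Longrightarrow> length (C i) = 12 * min (i + 1) (2 * r - i) - 6"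
    and aux_separates: "\<And>i. i < 2 * r \<Longrightarrow>
      set (C i) = {a \<in> parcs G. layer (left_face rot a) = i \<and>
                                layer (left_face rot (prod.swap a)) = i + 1}"
    and aux_disjoint: "\<And>i j. i < j \<Longrightarrow> j < 2 * r \<Longrightarrow> cycle_verts (C i) \<inter> cycle_verts (C j) = {}"
    and aux_cover: "(\<Union>i<2 * r. cycle_verts (C i)) = pverts G"
    and radial_consecutive: "\<And>u v. (u, v) \<in> radial_arcs r G C \<Longrightarrow>
      \<exists>i. i + 1 < 2 * r \<and> (u \<in> cycle_verts (C i) \<and> v \<in> cycle_verts (C (i + 1)) \<or>
                           v \<in> cycle_verts (C i) \<and> u \<in> cycle_verts (C (i + 1)))"
    and radial_perfect_matching: "\<And>v. v \<in> pverts G \<Longrightarrow> \<exists>!w. (v, w) \<in> radial_arcs r G C"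

definition central_layer ::
  "nat \<Rightarrow> 'a pair_pre_digraph \<Rightarrow> (nat \<Rightarrow> ('a \<times> 'a) list) \<Rightarrow> 'a pair_pre_digraph" where
  "central_layer r G C =
     (let A = cycle_verts (C (r - 1)); B = cycle_verts (C r) in
       \<lparr>pverts = A \<union> B,
        parcs = set (C (r - 1)) \<union> (set (C (r - 1)))\<inverse> \<union> set (C r) \<union> (set (C r))\<inverse> \<union>
                (radial_arcs r G C \<inter> (A \<times> B \<union> B \<times> A))\<rparr>)"

end

theory Submission
  imports Defs
begin

text \<open>
  Colour all radial edges and all vertices of degree two of the central layer with one colour. What
  remains are choices of permutations of the other three colours at the ends of the radial edges,
  constrained only by neighbouring radial edges.

  On the auxiliary cycles of the inner half no two consecutive vertices have inward radial edges: by
  induction on the layer, the path that a hexagon shares with its inner cycle has at most two edges,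
  so the one shared with the outer cycle has at least two. With the mirrored statement for the outer half,
  every face of the central layer has one or two edges on each of its two cycles, and not one on
  both. As the two cycles have equal length, pentagons with the short path inside and with the short
  path outside are equally frequent. A hexagon allows every state to be repeated, so only the cyclic
  word of the pentagons matters, and a finite state computation gives a closed sequence of states
  for each balanced cyclic word: it suffices to rotate the word so that the two kinds of pentagons
  alternate twice at its beginning, or so that a run of at least two equal pentagons is enclosed by the
  other kind.
\<close>

section \<open>Sequences of states along a ring of faces\<close>

text \<open>
  Colour \<open>3\<close> is reserved for the radial edges and the vertices of degree two. An \<open>end_cols\<close> lists the
  colours of an end of a radial edge, of the cycle edge before it and of the cycle edge after it. In
  \<open>gap_ok g\<close>, the flag \<open>g\<close> tells whether the next such end is adjacent on the cycle; otherwise one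
  vertex of degree two lies between. A face of the central layer is the pair of the flags of its
  inner and its outer gap.
\<close>

type_synonym end_cols = "nat \<times> nat \<times> nat"
type_synonym rung_cols = "end_cols \<times> end_cols"

fun gap_ok :: "bool \<Rightarrow> end_cols \<Rightarrow> end_cols \<Rightarrow> bool" where
  "gap_ok g (x, l, r) (x', l', r') \<longleftrightarrow> (if g then l' = r \<and> x' \<noteq> x else l' \<noteq> r)"

definition end_states :: "end_cols list" where
  "end_states = [(0,1,2),(0,2,1),(1,0,2),(1,2,0),(2,0,1),(2,1,0)]"

text \<open>A rung is a radial edge of the central layer, its inner end first. Its two ends are
  adjacent vertices, hence the condition on their colours.\<close>

definition rung_states :: "rung_cols list" where
  "rung_states = [(s, t) \<leftarrow> List.product end_states end_states. fst s \<noteq> fst t]"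

fun cell_ok :: "bool \<times> bool \<Rightarrow> rung_cols \<Rightarrow> rung_cols \<Rightarrow> bool" where
  "cell_ok (g, h) (s, t) (s', t') \<longleftrightarrow> gap_ok g s s' \<and> gap_ok h t t'"

fun walk :: "(bool \<times> bool) list \<Rightarrow> rung_cols \<Rightarrow> rung_cols \<Rightarrow> bool" where
  "walk [] s t \<longleftrightarrow> s = t"
| "walk (a # w) s t \<longleftrightarrow> (\<exists>u\<in>set rung_states. cell_ok a s u \<and> walk w u t)"

definition closed_walk :: "(bool \<times> bool) list \<Rightarrow> bool" where
  "closed_walk w \<longleftrightarrow> (\<exists>s\<in>set rung_states. walk w s s)"

text \<open>Filtering the fixed list \<open>rung_states\<close> represents every set of states by a
  single list, so reachable sets can be compared as lists by evaluation.\<close>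

definition succs :: "bool \<times> bool \<Rightarrow> rung_cols list \<Rightarrow> rung_cols list" where
  "succs a xs = filter (\<lambda>t. list_ex (\<lambda>s. cell_ok a s t) xs) rung_states"

text \<open>A fixed state to start from; that the required words can return to it is certified by
  evaluation in \<open>absorbing_reach\<close> and \<open>closed_walk_two_pents\<close>.\<close>

definition base_state :: rung_cols where "base_state = ((0,1,2),(2,1,0))"

abbreviation "top_pent \<equiv> (True, False)"
abbreviation "bot_pent \<equiv> (False, True)"

section \<open>Walks of states and their symmetries\<close>

lemma walk_append: "walk (u @ v) s t \<longleftrightarrow> (\<exists>m. walk u s m \<and> walk v m t)"
  by (induction u arbitrary: s) (simp, simp del: split_paired_Ex cell_ok.simps, blast)

lemma walk_states: "walk w s t \<Longrightarrow> s \<in> set rung_states \<Longrightarrow> t \<in> set rung_states"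
  by (induction w arbitrary: s) auto

text \<open>A closed walk can be cut open at any of its states, so only the cyclic word
  matters.\<close>

lemma closed_walk_rotate: "closed_walk (u @ v) \<Longrightarrow> closed_walk (v @ u)"
  unfolding closed_walk_def walk_append by (meson walk_states)

lemma rung_states_iff:
  "(s, t) \<in> set rung_states \<longleftrightarrow> s \<in> set end_states \<and> t \<in> set end_states \<and> fst s \<noteq> fst t"
  by (auto simp: rung_states_def)

lemma end_states_iff:
  "(x, l, r) \<in> set end_states \<longleftrightarrow> x < 3 \<and> l < 3 \<and> r < 3 \<and> x \<noteq> l \<and> x \<noteq> r \<and> l \<noteq> r"
proof
  assume "x < 3 \<and> l < 3 \<and> r < 3 \<and> x \<noteq> l \<and> x \<noteq> r \<and> l \<noteq> r"
  moreover have "n < 3 \<Longrightarrow> n = 0 \<or> n = 1 \<or> n = 2" for n :: nat by auto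
  ultimately have "x = 0 \<or> x = 1 \<or> x = 2" "l = 0 \<or> l = 1 \<or> l = 2" "r = 0 \<or> r = 1 \<or> r = 2"
    "x \<noteq> l" "x \<noteq> r" "l \<noteq> r" by blast+
  then show "(x, l, r) \<in> set end_states"
    unfolding end_states_def by (elim disjE) simp_all
qed (auto simp: end_states_def)

lemma swap_rung_states: "prod.swap s \<in> set rung_states \<longleftrightarrow> s \<in> set rung_states"
  by (cases s) (auto simp: rung_states_iff)

lemma cell_ok_swap: "cell_ok (prod.swap a) (prod.swap s) (prod.swap t) \<longleftrightarrow> cell_ok a s t"
  by (cases a; cases s; cases t) auto

text \<open>Exchanging the two cycles preserves all conditions and interchanges the two kinds of
  pentagons, which later saves half of the cases with a run of equal letters.\<close>

lemma walk_swap: "walk w s t \<Longrightarrow> walk (map prod.swap w) (prod.swap s) (prod.swap t)"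
proof (induction w arbitrary: s)
  case (Cons a w)
  then obtain u where "u \<in> set rung_states" "cell_ok a s u" "walk w u t" by auto
  with Cons.IH[of u] show ?case
    by (auto simp: swap_rung_states cell_ok_swap intro!: bexI[of _ "prod.swap u"])
qed simp

lemma closed_walk_swap: "closed_walk (map prod.swap w) \<longleftrightarrow> closed_walk w"
proof
  assume "closed_walk w" then show "closed_walk (map prod.swap w)"
    unfolding closed_walk_def using walk_swap swap_rung_states by blast
next
  assume "closed_walk (map prod.swap w)"
  then have "closed_walk (map prod.swap (map prod.swap w))"
    unfolding closed_walk_def using walk_swap swap_rung_states by blast
  then show "closed_walk w" by (simp add: comp_def)
qed

text \<open>Both gaps of a hexagon contain a vertex of degree two, which only asks that the cycle
  edges around it differ. Repeating the state satisfies this.\<close>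

lemma cell_ok_hexagon: "s \<in> set rung_states \<Longrightarrow> cell_ok (False, False) s s"
  by (cases s) (auto simp: rung_states_iff end_states_iff)

lemma walk_filter:
  "walk (filter (\<lambda>a. a \<noteq> (False, False)) w) s t \<Longrightarrow> s \<in> set rung_states \<Longrightarrow> walk w s t"
proof (induction w arbitrary: s)
  case (Cons a w)
  show ?case
  proof (cases "a = (False, False)")
    case True
    with Cons.prems have "walk w s t" by (intro Cons.IH) simp_all
    with True Cons.prems cell_ok_hexagon show ?thesis unfolding walk.simps by blast
  next
    case False
    with Cons.prems obtain u where "u \<in> set rung_states" "cell_ok a s u"
      "walk (filter (\<lambda>a. a \<noteq> (False, False)) w) u t"
      by (auto simp del: cell_ok.simps)
    with Cons.IH show ?thesis unfolding walk.simps by blast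
  qed
qed simp

lemma closed_walk_filter: "closed_walk (filter (\<lambda>a. a \<noteq> (False, False)) w) \<Longrightarrow> closed_walk w"
  unfolding closed_walk_def using walk_filter by blast

section \<open>Sets of reachable states\<close>

lemma mem_succs: "t \<in> set (succs a xs) \<longleftrightarrow> t \<in> set rung_states \<and> (\<exists>s\<in>set xs. cell_ok a s t)"
  by (auto simp: succs_def list_ex_iff)

lemma walk_fold_succs: "t \<in> set (fold succs w xs) \<Longrightarrow> \<exists>s\<in>set xs. walk w s t"
proof (induction w arbitrary: xs)
  case (Cons a w)
  from Cons.IH[of "succs a xs"] Cons.prems obtain u where "u \<in> set (succs a xs)" "walk w u t" by fastforce
  then show ?case unfolding mem_succs walk.simps by blast
qed simp

lemma closed_walkI: "base_state \<in> set (fold succs w [base_state]) \<Longrightarrow> closed_walk w"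
  unfolding closed_walk_def by (drule walk_fold_succs) (auto simp: base_state_def rung_states_iff end_states_iff)

text \<open>
  The states reachable from \<open>base_state\<close> by words starting with \<open>bot_pent\<close> and at least two
  \<open>top_pent\<close> recur with period 3.
\<close>

definition "reach1 = fold succs [bot_pent, top_pent, top_pent] [base_state]"
definition "reach2 = succs top_pent reach1"
definition "reach3 = succs top_pent reach2"
definition "reach_alt = fold succs [bot_pent, top_pent, bot_pent, top_pent] [base_state]"

lemma reach_cycle: "succs top_pent reach3 = reach1"
  by code_simp

lemma fold_top_pents: "fold succs (replicate j top_pent) reach1 \<in> {reach1, reach2, reach3}"
proof (induction j)
  case (Suc j)
  have "fold succs (replicate (Suc j) top_pent) reach1
    = succs top_pent (fold succs (replicate j top_pent) reach1)"
    unfolding replicate_Suc replicate_append_same[symmetric] by simp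
  with Suc reach_cycle show ?case by (auto simp: reach2_def[symmetric] reach3_def[symmetric])
qed simp

text \<open>Every state has a predecessor for either kind of pentagon, so once all states are
  reachable they remain so.\<close>

lemma succs_all_states:
  "succs top_pent rung_states = rung_states" "succs bot_pent rung_states = rung_states"
  by code_simp+

lemma fold_succs_all_states:
  "set w \<subseteq> {top_pent, bot_pent} \<Longrightarrow> fold succs w rung_states = rung_states"
  by (induction w) (auto simp: succs_all_states)

text \<open>Any two further letters make every state reachable; the first two conditions cover the
  continuations by no letter and by one letter.\<close>

definition absorbing :: "rung_cols list \<Rightarrow> bool" where
  "absorbing xs \<longleftrightarrow> base_state \<in> set xs \<and> (\<forall>a\<in>{top_pent, bot_pent}.
     base_state \<in> set (succs a xs) \<and> (\<forall>b\<in>{top_pent, bot_pent}. succs b (succs a xs) = rung_states))"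

lemma base_state_in: "base_state \<in> set rung_states"
  by (auto simp: base_state_def rung_states_iff end_states_iff)

lemma absorbing_fold:
  assumes "absorbing xs" "set w \<subseteq> {top_pent, bot_pent}"
  shows "base_state \<in> set (fold succs w xs)"
proof (cases w)
  case Nil
  then show ?thesis using assms by (simp add: absorbing_def)
next
  case w: (Cons a v)
  show ?thesis
  proof (cases v)
    case Nil
    then show ?thesis using assms w by (auto simp: absorbing_def)
  next
    case (Cons b u)
    then have "fold succs w xs = rung_states"
      using assms w fold_succs_all_states[of u] by (auto simp: absorbing_def)
    then show ?thesis by (simp add: base_state_in)
  qed
qed

section \<open>Closing up words of pentagons\<close>

lemma absorbing_reach:
  "absorbing (succs bot_pent reach1)" "absorbing (succs bot_pent reach2)"
  "absorbing (succs bot_pent reach3)" "absorbing reach_alt"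
  by code_simp+

text \<open>However long the run of \<open>top_pent\<close> continues in \<open>v\<close>, the set
  reached by its end is one of three, and the next \<open>bot_pent\<close> makes it
  absorbing.\<close>

lemma closed_walk_two_top:
  assumes "set v \<subseteq> {top_pent, bot_pent}" "bot_pent \<in> set v"
  shows "closed_walk (bot_pent # top_pent # top_pent # v)"
proof -
  obtain y z where v: "v = y @ bot_pent # z" and "bot_pent \<notin> set y"
    using assms(2) by (metis split_list_first)
  then have y: "y = replicate (length y) top_pent"
    using assms(1) by (intro replicate_eqI) auto
  have "fold succs (bot_pent # top_pent # top_pent # v) [base_state]
    = fold succs z (succs bot_pent (fold succs (replicate (length y) top_pent) reach1))"
    unfolding v by (subst y) (simp add: reach1_def)
  moreover have "absorbing (succs bot_pent (fold succs (replicate (length y) top_pent) reach1))"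
    using fold_top_pents[of "length y"] absorbing_reach by auto
  ultimately show ?thesis
    using assms(1) by (intro closed_walkI) (simp add: v absorbing_fold)
qed

lemma closed_walk_two_bot:
  assumes "set v \<subseteq> {top_pent, bot_pent}" "top_pent \<in> set v"
  shows "closed_walk (top_pent # bot_pent # bot_pent # v)"
proof -
  have "closed_walk (bot_pent # top_pent # top_pent # map prod.swap v)"
    using assms by (intro closed_walk_two_top) force+
  then have "closed_walk (map prod.swap (top_pent # bot_pent # bot_pent # v))"
    by simp
  then show ?thesis unfolding closed_walk_swap .
qed

lemma closed_walk_alternating:
  assumes "set v \<subseteq> {top_pent, bot_pent}"
  shows "closed_walk (bot_pent # top_pent # bot_pent # top_pent # v)"
proof (rule closed_walkI)
  have "fold succs (bot_pent # top_pent # bot_pent # top_pent # v) [base_state] = fold succs v reach_alt"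
    by (simp add: reach_alt_def)
  then show "base_state \<in> set (fold succs (bot_pent # top_pent # bot_pent # top_pent # v) [base_state])"
    using absorbing_fold[OF absorbing_reach(4) assms] by simp
qed

lemma closed_walk_two_pents: "closed_walk [bot_pent, top_pent]"
  by (rule closed_walkI) code_simp

lemma count_list_pos: "x \<in> set w \<longleftrightarrow> 0 < count_list w x"
  by (metis count_list_0_iff gr0I less_numeral_extra(3))

text \<open>Rotate so that the word starts with the last \<open>bot_pent\<close> of a run, followed
  by a \<open>top_pent\<close>. The next one or two letters decide which of the preceding lemmas
  applies, and balance supplies the further letter it needs.\<close>

lemma closed_walk_pents:
  assumes "set w \<subseteq> {top_pent, bot_pent}" "count_list w top_pent = count_list w bot_pent"
  shows "closed_walk w"
proof (cases "w = []")
  case True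
  then show ?thesis using base_state_in by (auto simp: closed_walk_def simp del: split_paired_Ex)
next
  case False
  then obtain a where "a \<in> set w" by (cases w) auto
  with assms(1) have "0 < count_list w top_pent \<or> 0 < count_list w bot_pent"
    unfolding count_list_pos[symmetric] by auto
  with assms(2) have mem: "bot_pent \<in> set w" "top_pent \<in> set w"
    unfolding count_list_pos by simp_all
  then obtain u v where w: "w = u @ bot_pent # v" by (meson split_list)
  with mem have "top_pent \<in> set (v @ u)" by auto
  then obtain y z where yz: "v @ u = y @ top_pent # z" and "top_pent \<notin> set y"
    by (meson split_list_first)
  have "set (v @ u) \<subseteq> {top_pent, bot_pent}" using assms(1) w by auto
  then have "bot_pent # y = replicate (Suc (length y)) bot_pent"
    using yz \<open>top_pent \<notin> set y\<close> by (intro replicate_eqI) auto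
  then have "y = replicate (length y) bot_pent" by simp
  \<comment> \<open>All letters of this run are equal, so the last one can be split off instead of
    the first. Rotating by \<open>y\<close> then starts the word at the end of the run.\<close>
  then have y: "bot_pent # y = y @ [bot_pent]" by (metis replicate_append_same)
  define x where "x = z @ y"
  have from_x: "closed_walk w" if "closed_walk (bot_pent # top_pent # x)"
  proof -
    have "closed_walk ((bot_pent # top_pent # z) @ y)" using that by (simp add: x_def)
    then have "closed_walk (y @ bot_pent # top_pent # z)" by (rule closed_walk_rotate)
    then have "closed_walk ((bot_pent # y) @ top_pent # z)" by (simp add: y)
    then have "closed_walk ((bot_pent # v) @ u)" using yz by simp
    then show ?thesis unfolding w by (rule closed_walk_rotate)
  qed
  have "set w = set (bot_pent # v @ u)" using w by auto
  then have x: "set x \<subseteq> {top_pent, bot_pent}"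
    using assms(1) yz by (auto simp: x_def)
  have "count_list w a = count_list (bot_pent # v @ u) a" for a using w by simp
  then have cnt: "count_list x top_pent = count_list x bot_pent"
    using assms(2) yz by (auto simp: x_def)
  show ?thesis
  proof (cases x)
    case Nil
    then show ?thesis using from_x closed_walk_two_pents by simp
  next
    case x1: (Cons a x')
    show ?thesis
    proof (cases "a = top_pent")
      case True
      then have "0 < count_list x' bot_pent" using cnt x1 by simp
      then show ?thesis using from_x closed_walk_two_top[of x'] x x1 True
        by (simp add: count_list_pos)
    next
      case False
      then have a: "a = bot_pent" using x x1 by auto
      then have "x' \<noteq> []" using cnt x1 by auto
      then obtain b x'' where x2: "x' = b # x''" by (cases x') auto
      show ?thesis
      proof (cases "b = top_pent")
        case True
        then show ?thesis using from_x closed_walk_alternating[of x''] x x1 x2 a by simp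
      next
        case False
        then have b: "b = bot_pent" using x x1 x2 by auto
        then have "0 < count_list x'' top_pent" using cnt x1 x2 a by simp
        \<comment> \<open>The leading \<open>bot_pent\<close> is moved to the end, so that the run
          of \<open>bot_pent\<close> in \<open>x\<close> is preceded by \<open>top_pent\<close>;
          balance leaves a \<open>top_pent\<close> after it.\<close>
        then have "closed_walk (top_pent # bot_pent # bot_pent # (x'' @ [bot_pent]))"
          using x x1 x2 by (intro closed_walk_two_bot) (auto simp: count_list_pos)
        then have "closed_walk ((top_pent # x) @ [bot_pent])" using x1 x2 a b by simp
        then have "closed_walk ([bot_pent] @ top_pent # x)" by (rule closed_walk_rotate)
        then show ?thesis using from_x by simp
      qed
    qed
  qed
qed

lemma count_list_filter: "P x \<Longrightarrow> count_list (filter P w) x = count_list w x"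
  by (induction w) auto

lemma closed_walk_balanced:
  assumes "(True, True) \<notin> set w" "count_list w top_pent = count_list w bot_pent"
  shows "closed_walk w"
proof (rule closed_walk_filter, rule closed_walk_pents)
  show "set (filter (\<lambda>a. a \<noteq> (False, False)) w) \<subseteq> {top_pent, bot_pent}"
    using assms(1) by auto
qed (simp add: assms count_list_filter)

section \<open>Concentric cycles joined by radial edges\<close>

text \<open>
  \<open>nx\<close> and \<open>pv\<close> move along the auxiliary cycles, \<open>lev\<close> numbers these cycles, \<open>mt\<close> is the other end
  of the radial edge and \<open>F\<close> the face successor. Whether the radial edge goes inward or outward fixes
  the rotation at its end.
\<close>

locale ring_map =
  fixes V :: "'a set" and nx pv mt :: "'a \<Rightarrow> 'a" and lev :: "'a \<Rightarrow> nat"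
    and F :: "'a \<times> 'a \<Rightarrow> 'a \<times> 'a" and r :: nat
  assumes nx_in: "v \<in> V \<Longrightarrow> nx v \<in> V" and pv_in: "v \<in> V \<Longrightarrow> pv v \<in> V"
    and mt_in: "v \<in> V \<Longrightarrow> mt v \<in> V"
    and nx_pv: "v \<in> V \<Longrightarrow> nx (pv v) = v" and pv_nx: "v \<in> V \<Longrightarrow> pv (nx v) = v"
    and mt_mt: "v \<in> V \<Longrightarrow> mt (mt v) = v"
    and lev_nx: "v \<in> V \<Longrightarrow> lev (nx v) = lev v" and lev_pv: "v \<in> V \<Longrightarrow> lev (pv v) = lev v"
    and lev_less: "v \<in> V \<Longrightarrow> lev v < 2 * r"
    and lev_mt: "v \<in> V \<Longrightarrow> lev (mt v) = lev v + 1 \<or> lev v = lev (mt v) + 1"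
    and inward_turn: "v \<in> V \<Longrightarrow> lev (mt v) < lev v \<Longrightarrow>
      F (mt v, v) = (v, nx v) \<and> F (pv v, v) = (v, mt v) \<and> F (nx v, v) = (v, pv v)"
    and outward_turn: "v \<in> V \<Longrightarrow> lev v < lev (mt v) \<Longrightarrow>
      F (mt v, v) = (v, pv v) \<and> F (pv v, v) = (v, nx v) \<and> F (nx v, v) = (v, mt v)"
    and face_period: "v \<in> V \<Longrightarrow> \<exists>N\<in>{5, 6}. (F ^^ N) (v, mt v) = (v, mt v) \<and>
      (\<forall>j. 0 < j \<and> j < N \<longrightarrow> (F ^^ j) (v, mt v) \<noteq> (v, mt v)) \<and>
      (max (lev v) (lev (mt v)) \<noteq> r \<longrightarrow> N = 6)"
begin

section \<open>Face successors by the direction of the radial edges\<close>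

definition inward :: "'a \<Rightarrow> bool" where "inward v \<longleftrightarrow> lev (mt v) < lev v"

lemma inward_mt:
  assumes "v \<in> V"
  shows "inward (mt v) \<longleftrightarrow> \<not> inward v"
  unfolding inward_def mt_mt[OF assms] using lev_mt[OF assms] by linarith

lemma F_into:
  assumes "v \<in> V"
  shows "F (mt v, v) = (v, if inward v then nx v else pv v)"
    "F (pv v, v) = (v, if inward v then mt v else nx v)"
    "F (nx v, v) = (v, if inward v then pv v else mt v)"
proof -
  consider "inward v" "lev (mt v) < lev v" | "\<not> inward v" "lev v < lev (mt v)"
    using lev_mt[OF assms] unfolding inward_def by linarith
  then have "F (mt v, v) = (v, if inward v then nx v else pv v) \<and>
    F (pv v, v) = (v, if inward v then mt v else nx v) \<and>
    F (nx v, v) = (v, if inward v then pv v else mt v)"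
    by cases (simp_all only: if_True if_False inward_turn[OF assms] outward_turn[OF assms] simp_thms)
  then show "F (mt v, v) = (v, if inward v then nx v else pv v)"
    "F (pv v, v) = (v, if inward v then mt v else nx v)"
    "F (nx v, v) = (v, if inward v then pv v else mt v)" by blast+
qed

text \<open>The turns of \<open>F_into\<close>, indexed by the tail of the arc, so that a face can
  be followed arc by arc.\<close>

lemma F_from:
  assumes "v \<in> V"
  shows "F (v, mt v) = (mt v, if inward v then pv (mt v) else nx (mt v))"
    "F (v, nx v) = (nx v, if inward (nx v) then mt (nx v) else nx (nx v))"
    "F (v, pv v) = (pv v, if inward (pv v) then pv (pv v) else mt (pv v))"
proof -
  show "F (v, mt v) = (mt v, if inward v then pv (mt v) else nx (mt v))"
    using F_into(1)[OF mt_in[OF assms]] unfolding mt_mt[OF assms] inward_mt[OF assms] by simp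
  show "F (v, nx v) = (nx v, if inward (nx v) then mt (nx v) else nx (nx v))"
    using F_into(2)[OF nx_in[OF assms]] unfolding pv_nx[OF assms] .
  show "F (v, pv v) = (pv v, if inward (pv v) then pv (pv v) else mt (pv v))"
    using F_into(3)[OF pv_in[OF assms]] unfolding nx_pv[OF assms] .
qed

text \<open>
  Reversing both the cycles and the order of the layers preserves all assumptions, so that every
  statement about the inner half has a counterpart for the outer half.
\<close>

lemma mirror: "ring_map V pv nx mt (\<lambda>v. 2 * r - 1 - lev v) F r"
proof
  fix v assume v: "v \<in> V"
  note lv = lev_less[OF v] lev_less[OF mt_in[OF v]] lev_mt[OF v]
  show "2 * r - 1 - lev (mt v) = 2 * r - 1 - lev v + 1 \<or>
      2 * r - 1 - lev v = 2 * r - 1 - lev (mt v) + 1" using lv by linarith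
  show "2 * r - 1 - lev v < 2 * r" using lv by linarith
  show "F (mt v, v) = (v, pv v) \<and> F (nx v, v) = (v, mt v) \<and> F (pv v, v) = (v, nx v)"
    if "2 * r - 1 - lev (mt v) < 2 * r - 1 - lev v"
    using outward_turn[OF v] that lv by auto
  show "F (mt v, v) = (v, nx v) \<and> F (nx v, v) = (v, pv v) \<and> F (pv v, v) = (v, mt v)"
    if "2 * r - 1 - lev v < 2 * r - 1 - lev (mt v)"
    using inward_turn[OF v] that lv by auto
  \<comment> \<open>The maximum is the layer of the face at a radial edge. The reflection sends
    layer \<open>i\<close> to \<open>2 * r - i\<close>, which fixes \<open>r\<close>.\<close>
  have "max (2 * r - 1 - x) (2 * r - 1 - y) \<noteq> r \<longleftrightarrow> max x y \<noteq> r"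
    if "x < 2 * r" "y < 2 * r" "y = x + 1 \<or> x = y + 1" for x y
    using that(3)
  proof
    assume y: "y = x + 1"
    then have "max (2 * r - 1 - x) (2 * r - 1 - y) = 2 * r - 1 - x" "max x y = x + 1" by simp_all
    then show ?thesis using that y by linarith
  next
    assume x: "x = y + 1"
    then have "max (2 * r - 1 - x) (2 * r - 1 - y) = 2 * r - 1 - y" "max x y = y + 1" by simp_all
    then show ?thesis using that x by linarith
  qed
  note this[OF lv]
  then show "\<exists>N\<in>{5, 6}. (F ^^ N) (v, mt v) = (v, mt v) \<and>
      (\<forall>j. 0 < j \<and> j < N \<longrightarrow> (F ^^ j) (v, mt v) \<noteq> (v, mt v)) \<and>
      (max (2 * r - 1 - lev v) (2 * r - 1 - lev (mt v)) \<noteq> r \<longrightarrow> N = 6)"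
    using face_period[OF v] by simp
qed (simp_all add: nx_in pv_in mt_in nx_pv pv_nx mt_mt lev_nx lev_pv)

section \<open>Paths of a face along two consecutive cycles\<close>

lemma funpow4: "(f ^^ 4) x = f (f (f (f x)))"
  and funpow5: "(f ^^ 5) x = f ((f ^^ 4) x)" and funpow6: "(f ^^ 6) x = f ((f ^^ 5) x)"
  by (simp_all add: eval_nat_numeral)

text \<open>
  The face entered through the arc from \<open>b\<close> inward to its mate runs backwards along the inner
  cycle to the next outward vertex, crosses to \<open>b'\<close> and runs forwards along the outer cycle. As it has
  at most six arcs, it cannot make a second crossing and hence returns to \<open>b\<close>.
\<close>

lemma face_one_step:
  assumes b: "b \<in> V" "inward b" and q: "q = pv (mt b)" "\<not> inward q" and b': "b' = mt q"
  shows "b = nx (nx b') \<and> \<not> inward (nx b') \<and> lev b = r \<or>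
    b = nx (nx (nx b')) \<and> \<not> inward (nx b') \<and> \<not> inward (nx (nx b'))"
proof -
  define c1 where "c1 = nx b'"
  define c2 where "c2 = nx c1"
  define c3 where "c3 = nx c2"
  have mem: "mt b \<in> V" "q \<in> V" "b' \<in> V" "c1 \<in> V" "c2 \<in> V" "c3 \<in> V"
    unfolding c3_def c2_def c1_def b' q(1) using b(1) by (simp_all add: mt_in pv_in nx_in)
  have levs: "lev (mt b) + 1 = lev b" using lev_mt[OF b(1)] b(2) by (auto simp: inward_def)
  have "lev q = lev (mt b)" unfolding q(1) by (rule lev_pv[OF mem(1)])
  moreover have "lev b' = lev q + 1" using lev_mt[OF mem(2)] q(2) unfolding inward_def b' by linarith
  ultimately have "lev b' = lev b" using levs by linarith
  then have levc: "lev c1 = lev b" "lev c2 = lev b" "lev c3 = lev b"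
    unfolding c1_def c2_def c3_def by (simp_all add: lev_nx nx_in mem)
  \<comment> \<open>A crossing changes the level, so an arc that starts at the mate of a vertex of
    this level is not the initial arc from \<open>b\<close>.\<close>
  have mtc: "lev (mt c) \<noteq> lev b" if "c \<in> V" "lev c = lev b" for c using lev_mt[OF that(1)] that(2) by linarith
  have s1: "F (b, mt b) = (mt b, q)" using F_from(1)[OF b(1)] b(2) unfolding q(1) by simp
  have s2: "F (mt b, q) = (q, b')"
    using F_from(3)[OF mem(1)] q(2) unfolding b' q(1) by simp
  have s3: "F (q, b') = (b', c1)"
    using F_from(1)[OF mem(2)] q(2) unfolding c1_def b' by simp
  have s4: "F (b', c1) = (c1, if inward c1 then mt c1 else c2)"
    using F_from(2)[OF mem(3)] unfolding c1_def c2_def .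
  have e4: "(F ^^ 4) (b, mt b) = (c1, if inward c1 then mt c1 else c2)"
    by (simp only: funpow4 s1 s2 s3 s4)
  obtain N where N: "N \<in> {5, 6}" "(F ^^ N) (b, mt b) = (b, mt b)"
    "\<And>j. 0 < j \<Longrightarrow> j < N \<Longrightarrow> (F ^^ j) (b, mt b) \<noteq> (b, mt b)"
    "max (lev b) (lev (mt b)) \<noteq> r \<Longrightarrow> N = 6" using face_period[OF b(1)] by metis
  have maxlev: "max (lev b) (lev (mt b)) = lev b" using levs by simp
  show ?thesis
  proof (cases "inward c1")
    case True
    \<comment> \<open>A second crossing at \<open>c1\<close> would make the fifth and sixth iterates
      start on the inner cycle, so the face could not close up in time.\<close>
    have e5: "(F ^^ 5) (b, mt b) = (mt c1, pv (mt c1))"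
      using e4 F_from(1)[OF mem(4)] True by (simp add: funpow5)
    have "fst ((F ^^ 6) (b, mt b)) = pv (mt c1)"
      using e5 F_from(3)[OF mt_in[OF mem(4)]] by (simp add: funpow6)
    then have "fst ((F ^^ N) (b, mt b)) = mt c1 \<or> fst ((F ^^ N) (b, mt b)) = pv (mt c1)"
      using N(1) e5 by auto
    then have "lev b = lev (mt c1)" using N(2) lev_pv[OF mt_in[OF mem(4)]] by auto
    then show ?thesis using mtc[OF mem(4) levc(1)] by simp
  next
    case nc1: False
    have e5: "(F ^^ 5) (b, mt b) = (c2, if inward c2 then mt c2 else c3)"
      using e4 F_from(2)[OF mem(4)] nc1 by (simp add: funpow5 c2_def c3_def)
    have e6: "fst ((F ^^ 6) (b, mt b)) = (if inward c2 then mt c2 else c3)"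
      using e5 F_from(1)[OF mem(5)] F_from(2)[OF mem(5)]
      by (cases "inward c2") (simp_all add: funpow6 c3_def)
    show ?thesis
    proof (cases "N = 5")
      case True
      then have "c2 = b" using e5 N(2) by simp
      moreover have "lev b = r" using N(4) True maxlev by auto
      ultimately show ?thesis using nc1 by (simp add: c1_def c2_def)
    next
      case False
      then have e: "b = (if inward c2 then mt c2 else c3)" using e6 N by simp
      then have "\<not> inward c2" using mtc[OF mem(5) levc(2)] by auto
      then show ?thesis using e nc1 by (simp add: c1_def c2_def c3_def)
    qed
  qed
qed

text \<open>Here the face has two edges on the inner cycle, with the inward vertex \<open>w\<close>
  between them. Four arcs are used when it arrives at \<open>b'\<close>, which leaves one outer edge
  for a pentagon and two for a hexagon.\<close>

lemma face_two_steps: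
  assumes b: "b \<in> V" "inward b" and w: "w = pv (mt b)" "inward w"
    and q: "q = pv w" "\<not> inward q" and b': "b' = mt q"
  shows "b = nx b' \<and> lev b = r \<or> b = nx (nx b') \<and> \<not> inward (nx b')"
proof -
  define c1 where "c1 = nx b'"
  define c2 where "c2 = nx c1"
  have mem: "mt b \<in> V" "w \<in> V" "q \<in> V" "b' \<in> V" "c1 \<in> V" "c2 \<in> V"
    unfolding c2_def c1_def b' q(1) w(1) using b(1) by (simp_all add: mt_in pv_in nx_in)
  have levs: "lev (mt b) + 1 = lev b" using lev_mt[OF b(1)] b(2) by (auto simp: inward_def)
  have "lev q = lev (mt b)" unfolding q(1) w(1) by (simp add: lev_pv pv_in mem)
  moreover have "lev b' = lev q + 1" using lev_mt[OF mem(3)] q(2) unfolding inward_def b' by linarith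
  ultimately have "lev b' = lev b" using levs by linarith
  then have levc: "lev c1 = lev b" "lev c2 = lev b"
    unfolding c1_def c2_def by (simp_all add: lev_nx nx_in mem)
  have mtc: "lev (mt c) \<noteq> lev b" if "c \<in> V" "lev c = lev b" for c using lev_mt[OF that(1)] that(2) by linarith
  have s1: "F (b, mt b) = (mt b, w)" using F_from(1)[OF b(1)] b(2) unfolding w(1) by simp
  have s2: "F (mt b, w) = (w, q)"
    using F_from(3)[OF mem(1)] w(2) unfolding q(1) w(1) by simp
  have s3: "F (w, q) = (q, b')"
    using F_from(3)[OF mem(2)] q(2) unfolding b' q(1) by simp
  have s4: "F (q, b') = (b', c1)"
    using F_from(1)[OF mem(3)] q(2) unfolding c1_def b' by simp
  have s5: "F (b', c1) = (c1, if inward c1 then mt c1 else c2)"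
    using F_from(2)[OF mem(4)] unfolding c1_def c2_def .
  have e5: "(F ^^ 5) (b, mt b) = (c1, if inward c1 then mt c1 else c2)"
    by (simp only: funpow5 funpow4 s1 s2 s3 s4 s5)
  have e6: "fst ((F ^^ 6) (b, mt b)) = (if inward c1 then mt c1 else c2)"
    using e5 F_from(1)[OF mem(5)] F_from(2)[OF mem(5)]
    by (cases "inward c1") (simp_all add: funpow6 c2_def)
  obtain N where N: "N \<in> {5, 6}" "(F ^^ N) (b, mt b) = (b, mt b)"
    "max (lev b) (lev (mt b)) \<noteq> r \<Longrightarrow> N = 6" using face_period[OF b(1)] by metis
  have maxlev: "max (lev b) (lev (mt b)) = lev b" using levs by simp
  show ?thesis
  proof (cases "N = 5")
    case True
    then have "c1 = b" using e5 N(2) by simp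
    moreover have "lev b = r" using N(3) True maxlev by auto
    ultimately show ?thesis by (simp add: c1_def)
  next
    case False
    then have e: "b = (if inward c1 then mt c1 else c2)" using e6 N by simp
    then have "\<not> inward c1" using mtc[OF mem(5) levc(1)] by auto
    then show ?thesis using e by (simp add: c1_def c2_def)
  qed
qed

text \<open>Level 0 has no inward vertices. At a higher level take the hexagon behind the second
  inward vertex \<open>b\<close>: by induction its inner path has one or two edges, so its outer
  path has three or two, and the vertex before \<open>b\<close> is outward.\<close>

lemma no_consecutive_inward:
  assumes "v \<in> V" "lev v < r"
  shows "\<not> (inward v \<and> inward (nx v))"
  using assms
proof (induction "lev v" arbitrary: v)
  case 0
  then have "lev v = 0" by simp
  then show ?case unfolding inward_def by simp
next
  case (Suc i)
  show ?case
  proof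
    assume v: "inward v \<and> inward (nx v)"
    define b where "b = nx v"
    define a where "a = mt b"
    define w where "w = pv a"
    define q where "q = pv w"
    have mem: "b \<in> V" "a \<in> V" "w \<in> V" "q \<in> V"
      using Suc.prems by (simp_all add: b_def a_def w_def q_def nx_in mt_in pv_in)
    have b: "inward b" "lev b = Suc i" "pv b = v" using v Suc by (simp_all add: b_def lev_nx pv_nx)
    have "lev a = i" using lev_mt[OF mem(1)] b by (auto simp: inward_def a_def)
    then have "lev q = i" using mem by (simp add: q_def w_def lev_pv)
    moreover have "nx q = w" using mem by (simp add: q_def nx_pv)
    ultimately have qw: "\<not> (inward q \<and> inward w)"
      using Suc.hyps(1)[of q] Suc.hyps(2) Suc.prems(2) mem(4) by simp
    \<comment> \<open>The level of \<open>b\<close> is below \<open>r\<close>, so the face is not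
      central and the pentagonal alternatives drop out.\<close>
    have nr: "lev b \<noteq> r" using b Suc by simp
    show False
    proof (cases "inward w")
      case False
      then have "b = nx (nx (nx (mt w)))" "\<not> inward (nx (nx (mt w)))"
        using face_one_step[OF mem(1) b(1) _ False refl] nr by (auto simp: w_def a_def)
      then have "\<not> inward (pv b)" using mem by (metis mt_in nx_in pv_nx)
      then show False using b v by simp
    next
      case True
      then have "b = nx (nx (mt q))" "\<not> inward (nx (mt q))"
        using face_two_steps[OF mem(1) b(1) _ True q_def _ refl] nr qw by (auto simp: w_def a_def)
      then have "\<not> inward (pv b)" using mem by (metis mt_in nx_in pv_nx)
      then show False using b v by simp
    qed
  qed
qed

lemma no_consecutive_outward:
  assumes v: "v \<in> V" "r \<le> lev v"
  shows "inward v \<or> inward (nx v)"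
proof -
  interpret M: ring_map V pv nx mt "\<lambda>v. 2 * r - 1 - lev v" F r by (rule mirror)
  have M: "M.inward u \<longleftrightarrow> \<not> inward u" if "u \<in> V" for u
    unfolding inward_def M.inward_def
    using lev_less[OF that] lev_less[OF mt_in[OF that]] lev_mt[OF that] by arith
  \<comment> \<open>The mirror image runs along the cycle from \<open>nx v\<close> to
    \<open>v\<close>, and levels from \<open>r\<close> on become levels below
    \<open>r\<close>.\<close>
  have "\<not> (M.inward (nx v) \<and> M.inward (pv (nx v)))"
    using v lev_less[OF v(1)] by (intro M.no_consecutive_inward) (simp_all add: nx_in lev_nx)
  then show ?thesis unfolding pv_nx[OF v(1)] M[OF v(1)] M[OF nx_in[OF v(1)]] by blast
qed

section \<open>The faces of the central layer\<close>

definition next_out :: "'a \<Rightarrow> 'a" where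
  "next_out v = (if inward (nx v) then nx (nx v) else nx v)"

text \<open>Used on the outer central cycle, where no two consecutive vertices are outward, so two
  steps suffice; \<open>next_out\<close> is used on the inner one, where no two are inward.\<close>

definition next_in :: "'a \<Rightarrow> 'a" where
  "next_in v = (if inward (nx v) then nx v else nx (nx v))"

lemma next_out:
  assumes "v \<in> V" "lev v + 1 = r"
  shows "next_out v \<in> V" "lev (next_out v) = lev v" "\<not> inward (next_out v)"
  using no_consecutive_inward[of "nx v"] assms by (auto simp: next_out_def nx_in lev_nx)

text \<open>The face between \<open>v\<close> and \<open>next_out v\<close> is followed from the
  outer end of the second radial edge inward, back to \<open>v\<close> and out again. Two
  single-edge gaps would leave it with only four edges.\<close>

lemma central_cell:
  assumes v: "v \<in> V" "lev v + 1 = r" "\<not> inward v"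
  shows "mt (next_out v) = next_in (mt v)" "inward (nx v) \<or> \<not> inward (nx (mt v))"
proof -
  define a where "a = next_out v"
  define b where "b = mt a"
  have a: "a \<in> V" "lev a = lev v" "\<not> inward a" using next_out[OF v(1,2)] by (simp_all add: a_def)
  have mem: "b \<in> V" "mt v \<in> V" using a v by (simp_all add: b_def mt_in)
  have b: "inward b" "mt b = a" using a by (simp_all add: b_def inward_mt mt_mt)
  have lmt: "lev (mt v) = r" using lev_mt[OF v(1)] v(2,3) by (auto simp: inward_def)
  have "b = next_in (mt v) \<and> (inward (nx v) \<or> \<not> inward (nx (mt v)))"
  proof (cases "inward (nx v)")
    case False
    then have "pv a = v" using v by (simp add: a_def next_out_def pv_nx)
    then have "b = nx (nx (mt v)) \<and> \<not> inward (nx (mt v)) \<or>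
        \<not> inward (nx (mt v)) \<and> \<not> inward (nx (nx (mt v)))"
      using face_one_step[OF mem(1) b(1) _ v(3) refl] b(2) by auto
    \<comment> \<open>Three outer edges would mean two consecutive outward vertices on level
      \<open>r\<close>.\<close>
    then show ?thesis using no_consecutive_outward[of "nx (mt v)"] mem lmt
      by (auto simp: next_in_def nx_in lev_nx)
  next
    case True
    then have pa: "pv a = nx v" "pv (nx v) = v" using v by (simp_all add: a_def next_out_def pv_nx nx_in)
    then have "b = nx (mt v) \<or> b = nx (nx (mt v)) \<and> \<not> inward (nx (mt v))"
      using face_two_steps[OF mem(1) b(1) _ True _ v(3) refl] b(2) by auto
    then show ?thesis using True b by (auto simp: next_in_def)
  qed
  then show "mt (next_out v) = next_in (mt v)" "inward (nx v) \<or> \<not> inward (nx (mt v))"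
    by (simp_all add: b_def a_def)
qed

end

section \<open>Colouring the central layer\<close>

text \<open>Two iterates coincide since \<open>S\<close> is finite, and injectivity cancels
  \<open>f\<close> until one of them is \<open>x\<close>.\<close>

lemma self_in_orbit_finite:
  assumes "finite S" "f ` S \<subseteq> S" "inj_on f S" "x \<in> S"
  shows "x \<in> orbit f x"
proof -
  have mem: "(f ^^ n) x \<in> S" for n using assms(2,4) by (induction n) auto
  then have "finite (range (\<lambda>n. (f ^^ n) x))" by (meson assms(1) finite_subset image_subsetI)
  then have "\<not> inj (\<lambda>n. (f ^^ n) x)" using finite_imageD infinite_UNIV_nat by blast
  then obtain i j where "i \<noteq> j" "(f ^^ i) x = (f ^^ j) x" unfolding inj_def by blast
  then obtain i j where ij: "i < j" "(f ^^ i) x = (f ^^ j) x"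
    using nat_neq_iff[of i j] by metis
  then have "\<exists>d>0. (f ^^ d) x = x"
  proof (induction i arbitrary: j)
    case 0
    then show ?case by auto
  next
    case (Suc i)
    then obtain j' where j: "j = Suc j'" by (cases j) auto
    then have "(f ^^ i) x = (f ^^ j') x" using Suc.prems mem assms(3) by (auto dest: inj_onD)
    with Suc j show ?case by auto
  qed
  then obtain d where "0 < d" "(f ^^ d) x = x" by blast
  then show ?thesis unfolding orbit_altdef by (intro CollectI exI[of _ d]) simp
qed

lemma count_list_map_distinct:
  "distinct xs \<Longrightarrow> count_list (map h xs) c = card {y \<in> set xs. h y = c}"
proof (induction xs)
  case (Cons y xs)
  have "{z \<in> set (y # xs). h z = c} = (if h y = c then insert y {z \<in> set xs. h z = c} else {z \<in> set xs. h z = c})"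
    by auto
  then show ?case using Cons by auto
qed simp

lemma walk_sequence:
  assumes "walk w s t"
  shows "\<exists>g. g 0 = s \<and> g (length w) = t \<and>
    (\<forall>j<length w. cell_ok (w ! j) (g j) (g (Suc j)) \<and> g (Suc j) \<in> set rung_states)"
  using assms
proof (induction w arbitrary: s)
  case (Cons a w)
  then obtain u where u: "u \<in> set rung_states" "cell_ok a s u" "walk w u t" unfolding walk.simps by blast
  from Cons.IH[OF u(3)] obtain g where g: "g 0 = u" "g (length w) = t"
    "\<forall>j<length w. cell_ok (w ! j) (g j) (g (Suc j)) \<and> g (Suc j) \<in> set rung_states" by blast
  define h where "h j = (case j of 0 \<Rightarrow> s | Suc i \<Rightarrow> g i)" for j
  have "cell_ok ((a # w) ! j) (h j) (h (Suc j)) \<and> h (Suc j) \<in> set rung_states"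
    if "j < length (a # w)" for j
    using that g u by (cases j) (simp_all add: h_def)
  then show ?case using g by (intro exI[of _ h]) (simp add: h_def)
qed auto

text \<open>The letters read once around the orbit form a balanced word; a closed walk for it gives
  a state to each position.\<close>

lemma closed_walk_orbit:
  assumes self: "x \<in> orbit f x" and fin: "finite (orbit f x)"
    and no: "\<And>v. v \<in> orbit f x \<Longrightarrow> letter v \<noteq> (True, True)"
    and balanced: "card {v \<in> orbit f x. letter v = top_pent} = card {v \<in> orbit f x. letter v = bot_pent}"
  shows "\<exists>st. \<forall>v\<in>orbit f x. st v \<in> set rung_states \<and> cell_ok (letter v) (st v) (st (f v))"
proof -
  define k where "k = funpow_dist1 f x x"
  define xs where "xs = map (\<lambda>n. (f ^^ n) x) [0..<k]"
  have inj: "inj_on (\<lambda>n. (f ^^ n) x) {0..<k}"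
    unfolding k_def by (rule inj_on_funpow_dist1[OF self])
  have orb: "orbit f x = (\<lambda>n. (f ^^ n) x) ` {0..<k}"
    unfolding k_def by (rule orbit_conv_funpow_dist1[OF self])
  have xs: "distinct xs" "set xs = orbit f x" "length xs = k"
    using inj orb by (simp_all add: xs_def distinct_map)
  have "(f ^^ k) x = x" unfolding k_def by (rule funpow_dist1_prop[OF self])
  have "closed_walk (map letter xs)"
  proof (rule closed_walk_balanced)
    show "(True, True) \<notin> set (map letter xs)" using no unfolding set_map xs(2) by (metis imageE)
    show "count_list (map letter xs) top_pent = count_list (map letter xs) bot_pent"
      using balanced unfolding count_list_map_distinct[OF xs(1)] xs(2) .
  qed
  then obtain s where s: "s \<in> set rung_states" "walk (map letter xs) s s"
    unfolding closed_walk_def by blast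
  from walk_sequence[OF s(2)] obtain g where g: "g 0 = s" "g k = s"
    "\<And>j. j < k \<Longrightarrow> cell_ok (letter (xs ! j)) (g j) (g (Suc j)) \<and> g (Suc j) \<in> set rung_states"
    by (auto simp: xs(3) simp del: split_paired_Ex)
  define st where "st v = g (the_inv_into {0..<k} (\<lambda>n. (f ^^ n) x) v)" for v
  have st: "st ((f ^^ j) x) = g j" if "j < k" for j
    using that by (simp add: st_def the_inv_into_f_f[OF inj])
  have "k > 0" by (simp add: k_def)
  \<comment> \<open>At the last position \<open>f\<close> returns to \<open>x\<close>, where the
    closed walk has its first state again.\<close>
  then have st_Suc: "st (f ((f ^^ j) x)) = g (Suc j)" if "j < k" for j
    using that st[of "Suc j"] st[of 0] g(1,2) \<open>(f ^^ k) x = x\<close> by (cases "Suc j = k") auto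
  have "st v \<in> set rung_states \<and> cell_ok (letter v) (st v) (st (f v))" if v: "v \<in> orbit f x" for v
  proof -
    obtain j where j: "j < k" "v = (f ^^ j) x" using v orb by auto
    have "g j \<in> set rung_states" using g s j by (cases j) (auto simp: less_Suc_eq)
    moreover have "xs ! j = v" using j by (simp add: xs_def)
    ultimately show ?thesis using g(3)[OF j(1)] st[OF j(1)] st_Suc[OF j(1)] j(2) by simp
  qed
  then show ?thesis by blast
qed

section \<open>States along the radial edges of the central layer\<close>

context ring_map begin

text \<open>Each radial edge of the central layer is represented by its inner end.\<close>

definition out_ring :: "'a set" where "out_ring = {v \<in> V. lev v + 1 = r \<and> \<not> inward v}"

text \<open>Stepping back along the cycle, past an inward vertex if there is one, inverts
  \<open>next_out\<close>.\<close>

lemma next_out_eq_iff: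
  assumes "u \<in> out_ring" "v \<in> out_ring" "next_out u = next_out v"
  shows "u = v"
proof -
  have *: "w = (if inward (pv (next_out w)) then pv (pv (next_out w)) else pv (next_out w))"
    if "w \<in> out_ring" for w
    using that by (auto simp: out_ring_def next_out_def pv_nx nx_in)
  show ?thesis using *[OF assms(1)] *[OF assms(2)] assms(3) by metis
qed

lemma next_out_out_ring: "v \<in> out_ring \<Longrightarrow> next_out v \<in> out_ring"
  using next_out[of v] by (simp add: out_ring_def)

text \<open>The radial edges form one orbit of \<open>next_out\<close>, along which the faces spell
  a cyclic word. Each of the two cycles has one vertex per radial edge and one more for each of its
  two-edge gaps, so equal lengths make the word balanced.\<close>

lemma central_states:
  assumes fin: "finite V"
    and single: "\<And>u v. u \<in> V \<Longrightarrow> v \<in> V \<Longrightarrow> lev u + 1 = r \<Longrightarrow> lev v + 1 = r \<Longrightarrow> \<exists>n. v = (nx ^^ n) u"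
    and card_eq: "card {v \<in> V. lev v + 1 = r} = card {v \<in> V. lev v = r}"
    and nonempty: "a \<in> V" "lev a + 1 = r"
  shows "\<exists>st. \<forall>v\<in>out_ring. st v \<in> set rung_states \<and>
    cell_ok (\<not> inward (nx v), inward (nx (mt v))) (st v) (st (next_out v))"
proof -
  have fin_out: "finite out_ring" using fin by (simp add: out_ring_def)
  obtain a0 where a0: "a0 \<in> out_ring"
    using no_consecutive_inward[of a] nonempty nx_in[of a] lev_nx[of a] by (auto simp: out_ring_def)
  have inj: "inj_on next_out out_ring" using next_out_eq_iff by (auto intro: inj_onI)
  have maps: "next_out ` out_ring \<subseteq> out_ring" using next_out_out_ring by auto
  have self: "a0 \<in> orbit next_out a0" by (rule self_in_orbit_finite[OF fin_out maps inj a0])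
  have iter: "(next_out ^^ n) a0 \<in> out_ring" for n
    using a0 next_out_out_ring by (induction n) auto
  \<comment> \<open>Along the walk by \<open>nx\<close>, the last outward vertex met is always an
    iterate of \<open>next_out\<close>. As the walk covers the whole cycle, so does the orbit cover
    \<open>out_ring\<close>.\<close>
  have reach: "(nx ^^ n) a0 \<in> V \<and> lev ((nx ^^ n) a0) + 1 = r \<and>
    (\<exists>m. (if inward ((nx ^^ n) a0) then pv ((nx ^^ n) a0) else (nx ^^ n) a0) = (next_out ^^ m) a0)" for n
  proof (induction n)
    case 0
    then show ?case using a0 by (auto simp: out_ring_def intro: exI[of _ 0])
  next
    case (Suc n)
    define w where "w = (nx ^^ n) a0"
    from Suc obtain m where w: "w \<in> V" "lev w + 1 = r"
      and m: "(if inward w then pv w else w) = (next_out ^^ m) a0" unfolding w_def by blast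
    have not2: "\<not> (inward w \<and> inward (nx w))" using w by (intro no_consecutive_inward) simp_all
    have "\<exists>m. (if inward (nx w) then pv (nx w) else nx w) = (next_out ^^ m) a0"
    proof (cases "inward w")
      case True
      then have "next_out (pv w) = nx w" by (simp add: next_out_def nx_pv[OF w(1)])
      moreover have "pv w = (next_out ^^ m) a0" using m True by simp
      ultimately have "nx w = (next_out ^^ Suc m) a0" unfolding funpow.simps comp_apply by metis
      then have "(if inward (nx w) then pv (nx w) else nx w) = (next_out ^^ Suc m) a0"
        using True not2 by simp
      then show ?thesis by blast
    next
      case False
      then have wm: "w = (next_out ^^ m) a0" using m by simp
      show ?thesis
      proof (cases "inward (nx w)")
        case True
        then have "(if inward (nx w) then pv (nx w) else nx w) = (next_out ^^ m) a0"
          unfolding pv_nx[OF w(1)] using wm by simp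
        then show ?thesis by blast
      next
        case False
        then have "next_out w = nx w" by (simp add: next_out_def)
        then have "nx w = (next_out ^^ Suc m) a0" by (simp add: wm)
        then have "(if inward (nx w) then pv (nx w) else nx w) = (next_out ^^ Suc m) a0"
          using False by simp
        then show ?thesis by blast
      qed
    qed
    moreover have "nx w \<in> V" "lev (nx w) + 1 = r" using w(2) nx_in[OF w(1)] lev_nx[OF w(1)] by simp_all
    ultimately show ?case unfolding w_def funpow.simps comp_apply by blast
  qed
  have orb: "orbit next_out a0 = out_ring"
  proof
    show "orbit next_out a0 \<subseteq> out_ring" using iter by (auto simp: orbit_altdef)
    show "out_ring \<subseteq> orbit next_out a0"
    proof
      fix v assume v: "v \<in> out_ring"
      then obtain n where "v = (nx ^^ n) a0" using single[of a0 v] a0 by (auto simp: out_ring_def)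
      then obtain m where "v = (next_out ^^ m) a0"
        using reach[of n] v by (auto simp: out_ring_def)
      then show "v \<in> orbit next_out a0" using self by (simp add: funpow_in_orbit)
    qed
  qed
  define letter where "letter v = (\<not> inward (nx v), inward (nx (mt v)))" for v
  have cell: "inward (nx v) \<or> \<not> inward (nx (mt v))" if "v \<in> out_ring" for v
    using central_cell(2)[of v] that by (simp add: out_ring_def)
  let ?gap1 = "{v \<in> out_ring. \<not> inward (nx v)}" and ?gap2 = "{v \<in> out_ring. inward (nx v)}"
  let ?outer_gap1 = "{v \<in> out_ring. inward (nx (mt v))}" and ?outer_gap2 = "{v \<in> out_ring. \<not> inward (nx (mt v))}"
  have mt_out: "mt v \<in> V" "lev (mt v) = r" "inward (mt v)" if "v \<in> out_ring" for v
    using that lev_mt[of v] by (auto simp: out_ring_def mt_in inward_mt) (auto simp: inward_def)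
  have inner: "{v \<in> V. lev v + 1 = r} = out_ring \<union> nx ` ?gap2"
  proof
    show "{v \<in> V. lev v + 1 = r} \<subseteq> out_ring \<union> nx ` ?gap2"
    proof
      fix v assume v: "v \<in> {v \<in> V. lev v + 1 = r}"
      show "v \<in> out_ring \<union> nx ` ?gap2"
      proof (cases "inward v")
        case True
        then have "pv v \<in> ?gap2" "nx (pv v) = v"
          using v no_consecutive_inward[of "pv v"] by (auto simp: out_ring_def pv_in lev_pv nx_pv)
        then show ?thesis by (metis UnI2 imageI)
      qed (use v in \<open>simp add: out_ring_def\<close>)
    qed
  qed (auto simp: out_ring_def nx_in lev_nx)
  have outer: "{v \<in> V. lev v = r} = mt ` out_ring \<union> (nx \<circ> mt) ` ?outer_gap2"
  proof
    show "{v \<in> V. lev v = r} \<subseteq> mt ` out_ring \<union> (nx \<circ> mt) ` ?outer_gap2"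
    proof
      fix v assume v: "v \<in> {v \<in> V. lev v = r}"
      have *: "mt w \<in> out_ring \<and> mt (mt w) = w" if "w \<in> V" "lev w = r" "inward w" for w
        using that lev_mt[of w] by (auto simp: out_ring_def mt_in inward_mt mt_mt) (auto simp: inward_def)
      show "v \<in> mt ` out_ring \<union> (nx \<circ> mt) ` ?outer_gap2"
      proof (cases "inward v")
        case True
        then show ?thesis using *[of v] v by (metis (mono_tags, lifting) UnI1 imageI mem_Collect_eq)
      next
        case False
        then have "inward (pv v)"
          using v no_consecutive_outward[of "pv v"] by (auto simp: pv_in lev_pv nx_pv)
        then have "mt (pv v) \<in> out_ring" "mt (mt (pv v)) = pv v" "nx (pv v) = v"
          using v *[of "pv v"] by (auto simp: pv_in lev_pv nx_pv)
        then show ?thesis using False by (intro UnI2 image_eqI[of _ _ "mt (pv v)"]) auto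
      qed
    qed
  qed (use mt_out in \<open>auto simp: nx_in lev_nx\<close>)
  have inj_nx: "inj_on nx V" by (metis inj_onI pv_nx)
  have inj_mt: "inj_on mt V" by (metis inj_onI mt_mt)
  have sub: "out_ring \<subseteq> V" by (auto simp: out_ring_def)
  have "inj_on nx ?gap2" using inj_nx sub by (rule_tac inj_on_subset) auto
  then have inner_card: "card {v \<in> V. lev v + 1 = r} = card out_ring + card ?gap2"
    unfolding inner using fin_out
    by (subst card_Un_disjoint) (simp_all add: card_image, auto simp: out_ring_def)
  have "inj_on mt out_ring" using inj_mt sub by (rule inj_on_subset)
  moreover have "inj_on (nx \<circ> mt) ?outer_gap2"
    using \<open>inj_on mt out_ring\<close> mt_out by (intro comp_inj_on inj_on_subset[OF inj_nx]) (auto intro: inj_on_subset)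
  moreover have "mt ` out_ring \<inter> (nx \<circ> mt) ` ?outer_gap2 = {}" by (auto, metis mt_out(3))
  ultimately have outer_card: "card {v \<in> V. lev v = r} = card out_ring + card ?outer_gap2"
    unfolding outer using fin_out finite_subset[of ?outer_gap2 out_ring]
    by (subst card_Un_disjoint) (simp_all only: card_image finite_imageI Collect_restrict)
  have "card out_ring = card ?gap1 + card ?gap2"
    using fin_out by (subst card_Un_disjoint[symmetric]) (auto intro: arg_cong[of _ _ card])
  moreover have "card out_ring = card ?outer_gap1 + card ?outer_gap2"
    using fin_out by (subst card_Un_disjoint[symmetric]) (auto intro: arg_cong[of _ _ card])
  ultimately have "card ?gap1 = card ?outer_gap1" using card_eq inner_card outer_card by linarith
  \<comment> \<open>By \<open>cell\<close>, a single-edge gap on one cycle excludes one on the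
    other, so one component determines these letters.\<close>
  moreover have "{v \<in> out_ring. letter v = top_pent} = ?gap1" "{v \<in> out_ring. letter v = bot_pent} = ?outer_gap1"
    using cell by (auto simp: letter_def)
  ultimately have "card {v \<in> out_ring. letter v = top_pent} = card {v \<in> out_ring. letter v = bot_pent}"
    by simp
  moreover have "letter v \<noteq> (True, True)" if "v \<in> out_ring" for v
    using cell[OF that] by (simp add: letter_def)
  ultimately show ?thesis
    using closed_walk_orbit[of a0 next_out letter] self fin_out unfolding orb letter_def by blast
qed

section \<open>The ends of the radial edges and the total colouring\<close>

definition on_ring :: "'a \<Rightarrow> bool" where
  "on_ring v \<longleftrightarrow> v \<in> V \<and> (lev v + 1 = r \<and> \<not> inward v \<or> lev v = r \<and> inward v)"

definition central :: "'a set" where "central = {v \<in> V. lev v + 1 = r \<or> lev v = r}"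

lemma on_ring_mt:
  assumes "on_ring v" shows "on_ring (mt v)"
  using assms lev_mt[of v] unfolding on_ring_def by (auto simp: mt_in inward_mt) (auto simp: inward_def)

text \<open>The vertices of \<open>central\<close> outside \<open>on_ring\<close> have degree two in
  the central layer; they are inward on the inner cycle and outward on the outer one, so no two are
  consecutive.\<close>

lemma on_ring_nx: "v \<in> central \<Longrightarrow> on_ring v \<or> on_ring (nx v)"
  using no_consecutive_inward[of v] no_consecutive_outward[of v]
  unfolding on_ring_def central_def by (auto simp: nx_in lev_nx)

lemma central_closed: "v \<in> central \<Longrightarrow> nx v \<in> central" "v \<in> central \<Longrightarrow> pv v \<in> central"
  by (auto simp: central_def nx_in pv_in lev_nx lev_pv)

text \<open>The states colour the ends of the radial edges and all cycle edges; everything else gets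
  \<open>3\<close>. Conflicts can be checked at a single vertex, which lies on two cycle edges and
  at most one radial edge.\<close>

lemma total_colorable_central:
  fixes H :: "'a pair_pre_digraph"
  assumes fin: "finite V"
    and single: "\<And>u v. u \<in> V \<Longrightarrow> v \<in> V \<Longrightarrow> lev u + 1 = r \<Longrightarrow> lev v + 1 = r \<Longrightarrow> \<exists>n. v = (nx ^^ n) u"
    and card_eq: "card {v \<in> V. lev v + 1 = r} = card {v \<in> V. lev v = r}"
    and nonempty: "a \<in> V" "lev a + 1 = r"
    and no_2_cycle: "\<And>v. v \<in> V \<Longrightarrow> nx (nx v) \<noteq> v"
    and verts: "pverts H = central"
    and edges: "edges H = (\<lambda>v. {v, nx v}) ` central \<union> (\<lambda>v. {v, mt v}) ` {v. on_ring v}"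
  shows "total_colorable 4 H"
proof -
  obtain st where st: "\<And>v. v \<in> out_ring \<Longrightarrow> st v \<in> set rung_states"
    "\<And>v. v \<in> out_ring \<Longrightarrow> cell_ok (\<not> inward (nx v), inward (nx (mt v))) (st v) (st (next_out v))"
    using central_states[OF fin single card_eq nonempty] by blast
  \<comment> \<open>States are indexed by inner ends, so an outer end consults its mate.\<close>
  define ends where "ends v = (if lev v = r then snd (st (mt v)) else fst (st v))" for v
  define nxt where "nxt v = (if on_ring (nx v) then nx v else nx (nx v))" for v
  have cases: "v \<in> out_ring \<and> ends v = fst (st v) \<and> ends (mt v) = snd (st v) \<or>
      mt v \<in> out_ring \<and> ends v = snd (st (mt v)) \<and> ends (mt v) = fst (st (mt v))" if v: "on_ring v" for v
  proof (cases "lev v = r")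
    case False
    then have "v \<in> out_ring" using v by (auto simp: on_ring_def out_ring_def)
    then have "lev v \<noteq> r" "lev (mt v) = r" "mt (mt v) = v"
      using lev_mt[of v] by (auto simp: out_ring_def inward_def mt_mt)
    with \<open>v \<in> out_ring\<close> show ?thesis by (simp add: ends_def)
  next
    case True
    then have "v \<in> V" "inward v" using v by (auto simp: on_ring_def)
    then have "lev (mt v) + 1 = r" using lev_mt[of v] True by (auto simp: inward_def)
    then have "mt v \<in> out_ring" "lev (mt v) \<noteq> r"
      using \<open>v \<in> V\<close> \<open>inward v\<close> by (auto simp: out_ring_def mt_in inward_mt)
    then show ?thesis using True by (simp add: ends_def)
  qed
  have ends_state: "ends v \<in> set end_states" and ends_mt: "fst (ends v) \<noteq> fst (ends (mt v))"
    if v: "on_ring v" for v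
  proof -
    have pair: "fst (st w) \<in> set end_states \<and> snd (st w) \<in> set end_states \<and> fst (fst (st w)) \<noteq> fst (snd (st w))"
      if "w \<in> out_ring" for w
      using st(1)[OF that] rung_states_iff[of "fst (st w)" "snd (st w)"] by simp
    show "ends v \<in> set end_states" using cases[OF v] pair by metis
    show "fst (ends v) \<noteq> fst (ends (mt v))" using cases[OF v] pair by metis
  qed
  have ends_gap: "gap_ok (on_ring (nx v)) (ends v) (ends (nxt v))" if v: "on_ring v" for v
  proof -
    have cell: "gap_ok (\<not> inward (nx w)) (fst (st w)) (fst (st (next_out w))) \<and>
        gap_ok (inward (nx (mt w))) (snd (st w)) (snd (st (next_out w)))" if "w \<in> out_ring" for w
      using st(2)[OF that] by (cases "st w"; cases "st (next_out w)") simp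
    show ?thesis
    proof (cases "lev v = r")
      case False
      then have w: "v \<in> out_ring" using v by (auto simp: on_ring_def out_ring_def)
      then have "on_ring (nx v) \<longleftrightarrow> \<not> inward (nx v)"
        by (auto simp: on_ring_def out_ring_def nx_in lev_nx)
      moreover from this have "nxt v = next_out v" by (simp add: nxt_def next_out_def)
      moreover have "lev (next_out v) \<noteq> r" using next_out_out_ring[OF w] by (auto simp: out_ring_def)
      ultimately show ?thesis using cell[OF w] False by (simp add: ends_def)
    next
      case True
      define w where "w = mt v"
      have v': "v \<in> V" "inward v" using v True by (auto simp: on_ring_def)
      have w: "w \<in> out_ring"
        using v' True lev_mt[of v] by (auto simp: out_ring_def w_def mt_in inward_mt) (auto simp: inward_def)
      have mw: "mt w = v" using v' by (simp add: w_def mt_mt)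
      have on: "on_ring (nx v) \<longleftrightarrow> inward (nx v)"
        using v' True by (auto simp: on_ring_def nx_in lev_nx)
      then have "nxt v = next_in v" by (simp add: nxt_def next_in_def)
      moreover have "mt (next_out w) = next_in v"
        using central_cell(1)[of w] w mw by (simp add: out_ring_def)
      moreover have "mt (mt (next_out w)) = next_out w"
        using next_out_out_ring[OF w] by (simp add: out_ring_def mt_mt)
      moreover have "lev (next_in v) = r" using v' True by (simp add: next_in_def lev_nx nx_in)
      ultimately have "ends (nxt v) = snd (st (next_out w))" by (simp add: ends_def)
      moreover have "ends v = snd (st w)" using True by (simp add: ends_def w_def)
      ultimately show ?thesis using cell[OF w] mw on by simp
    qed
  qed
  define vcol where "vcol v = (if on_ring v then fst (ends v) else 3)" for v
  \<comment> \<open>This is the colour of the edge from \<open>v\<close> to \<open>nx v\<close>. If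
    \<open>v\<close> has degree two, then \<open>nx v\<close> is an end of a radial edge and
    supplies it.\<close>
  define ecol where "ecol v = (if on_ring v then snd (snd (ends v)) else fst (snd (ends (nx v))))" for v
  have cV: "v \<in> V" if "v \<in> central" for v using that by (simp add: central_def)
  have cR: "v \<in> central" if "on_ring v" for v using that by (auto simp: central_def on_ring_def)
  have ends3: "fst (ends v) < 3 \<and> fst (snd (ends v)) < 3 \<and> snd (snd (ends v)) < 3 \<and>
    fst (ends v) \<noteq> fst (snd (ends v)) \<and> fst (ends v) \<noteq> snd (snd (ends v)) \<and>
    fst (snd (ends v)) \<noteq> snd (snd (ends v))" if "on_ring v" for v
    using ends_state[OF that] end_states_iff[of "fst (ends v)" "fst (snd (ends v))" "snd (snd (ends v))"]
    by simp
  have gap: "(if on_ring (nx v) then fst (snd (ends (nx v))) = snd (snd (ends v)) \<and> fst (ends (nx v)) \<noteq> fst (ends v)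
      else fst (snd (ends (nx (nx v)))) \<noteq> snd (snd (ends v)))" if "on_ring v" for v
    using ends_gap[OF that] by (cases "ends v"; cases "ends (nxt v)") (simp add: nxt_def split: if_splits)
  have ecol_lt: "ecol v < 3" if "v \<in> central" for v
    using ends3[of v] ends3[of "nx v"] on_ring_nx[OF that] by (auto simp: ecol_def)
  \<comment> \<open>If \<open>pv v\<close> is an end too, the edge is coloured from there, and
    \<open>gap_ok\<close> for adjacent ends makes the two values agree.\<close>
  have ecol_pv: "ecol (pv v) = fst (snd (ends v))" if v: "on_ring v" for v
    using gap[of "pv v"] v nx_pv[OF cV[OF cR[OF v]]] by (auto simp: ecol_def)
  have ecol_ne: "ecol v \<noteq> ecol (pv v)" if v: "v \<in> central" for v
  proof (cases "on_ring v")
    case True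
    then show ?thesis using ecol_pv[OF True] ends3[OF True] by (simp add: ecol_def)
  next
    case False
    then have "on_ring (pv v)"
      using on_ring_nx[OF central_closed(2)[OF v]] nx_pv[OF cV[OF v]] by simp
    then show ?thesis using gap[of "pv v"] False nx_pv[OF cV[OF v]] by (simp add: ecol_def)
  qed
  have vcol_ecol: "vcol v \<noteq> ecol v" "vcol v \<noteq> ecol (pv v)" if v: "v \<in> central" for v
    using ends3[of v] ecol_pv[of v] ecol_lt[OF v] ecol_lt[OF central_closed(2)[OF v]]
    by (auto simp: vcol_def ecol_def)
  have vcol_nx: "vcol v \<noteq> vcol (nx v)" if v: "v \<in> central" for v
    using ends3[of v] ends3[of "nx v"] gap[of v] on_ring_nx[OF v] by (auto simp: vcol_def)
  have vcol_mt: "vcol v \<noteq> vcol (mt v)" "vcol v < 3" if v: "on_ring v" for v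
    using ends_mt[OF v] v on_ring_mt[OF v] ends3[OF v] by (simp_all add: vcol_def)
  \<comment> \<open>A cycle edge is identified by its tail, which is unique because
    \<open>nx\<close> has no 2-cycles; the default \<open>3\<close> is for the radial edges.\<close>
  define c where "c = (\<lambda>x. case x of Inl v \<Rightarrow> vcol v
    | Inr e \<Rightarrow> if \<exists>v\<in>central. e = {v, nx v} then ecol (THE v. v \<in> central \<and> e = {v, nx v}) else 3)"
  have c_nx: "c (Inr {v, nx v}) = ecol v" if v: "v \<in> central" for v
  proof -
    have "(THE u. u \<in> central \<and> {v, nx v} = {u, nx u}) = v"
    proof (rule the_equality)
      fix u assume u: "u \<in> central \<and> {v, nx v} = {u, nx u}"
      then have "u = v \<or> u = nx v \<and> nx u = v" by (auto simp: doubleton_eq_iff)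
      then show "u = v" using no_2_cycle[OF cV[OF v]] by auto
    qed (use v in simp)
    then show ?thesis using v by (auto simp: c_def)
  qed
  have c_mt: "c (Inr {v, mt v}) = 3" if v: "on_ring v" for v
  proof -
    have "{v, mt v} \<noteq> {u, nx u}" if u: "u \<in> central" for u
    proof
      assume "{v, mt v} = {u, nx u}"
      then have "lev (mt v) = lev v" using lev_nx[OF cV[OF u]] by (auto simp: doubleton_eq_iff)
      then show False using lev_mt[OF cV[OF cR[OF v]]] by simp
    qed
    then show ?thesis by (auto simp: c_def)
  qed
  have incident: "v \<in> central \<and> (e = {v, nx v} \<or> e = {pv v, v} \<or> on_ring v \<and> e = {v, mt v})"
    if e: "e \<in> edges H" "v \<in> e" for e v
  proof -
    consider u where "u \<in> central" "e = {u, nx u}" | u where "on_ring u" "e = {u, mt u}"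
      using e(1) edges by auto
    then show ?thesis
    proof cases
      case 1
      then have "v = u \<or> v = nx u \<and> u = pv v" using e(2) pv_nx[OF cV] by auto
      then show ?thesis using 1 central_closed by (metis nx_pv cV)
    next
      case 2
      then have "v = u \<or> v = mt u \<and> u = mt v" using e(2) mt_mt[OF cV[OF cR]] by auto
      then show ?thesis using 2 on_ring_mt cR by (metis insert_commute)
    qed
  qed
  have c_pv: "c (Inr {pv v, v}) = ecol (pv v)" if v: "v \<in> central" for v
    using c_nx[OF central_closed(2)[OF v]] nx_pv[OF cV[OF v]] by simp
  have arcs: "{u, v} \<in> edges H" if "(u, v) \<in> parcs H" for u v
    using that by (force simp: edges_def)
  have "total_coloring H c"
    unfolding total_coloring_def
  proof (intro conjI allI impI ballI)
    fix u v assume "(u, v) \<in> parcs H"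
    then have "{u, v} \<in> edges H" by (rule arcs)
    then consider w where "w \<in> central" "{u, v} = {w, nx w}" | w where "on_ring w" "{u, v} = {w, mt w}"
      using edges by auto
    then show "c (Inl u) \<noteq> c (Inl v)"
    proof cases
      case 1
      then show ?thesis using vcol_nx[OF 1(1)] by (auto simp: c_def doubleton_eq_iff)
    next
      case 2
      then show ?thesis using vcol_mt(1)[OF 2(1)] by (auto simp: c_def doubleton_eq_iff)
    qed
  next
    fix e f assume e: "e \<in> edges H" and f: "f \<in> edges H" and ef: "e \<noteq> f \<and> e \<inter> f \<noteq> {}"
    then obtain v where v: "v \<in> e" "v \<in> f" by auto
    have vc: "v \<in> central" using incident[OF e v(1)] by blast
    have lt: "ecol v < 3" "ecol (pv v) < 3" using ecol_lt vc central_closed(2) by blast+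
    show "c (Inr e) \<noteq> c (Inr f)"
      using incident[OF e v(1)] incident[OF f v(2)] ef c_nx[OF vc] c_pv[OF vc] c_mt[of v] ecol_ne[OF vc] lt
      by (elim conjE disjE) simp_all
  next
    fix e v assume e: "e \<in> edges H" and v: "v \<in> e"
    have vc: "v \<in> central" using incident[OF e v] by blast
    have "c (Inl v) = vcol v" by (simp add: c_def)
    then show "c (Inl v) \<noteq> c (Inr e)"
      using incident[OF e v] c_nx[OF vc] c_pv[OF vc] c_mt[of v] vcol_ecol[OF vc] vcol_mt(2)[of v]
      by (elim conjE disjE) simp_all
  qed
  moreover have "c ` (pverts H <+> edges H) \<subseteq> {..<4}"
  proof
    fix k assume "k \<in> c ` (pverts H <+> edges H)"
    then consider v where "k = c (Inl v)" | e where "k = c (Inr e)" "e \<in> edges H" by auto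
    then have "k < 4"
    proof cases
      case 1
      then show ?thesis using ends3[of v] by (auto simp: c_def vcol_def)
    next
      case 2
      then consider v where "v \<in> central" "k = ecol v" | "k = 3"
        using edges c_nx c_mt by auto
      then show ?thesis using ecol_lt by cases force+
    qed
    then show "k \<in> {..<4}" by simp
  qed
  ultimately show ?thesis unfolding total_colorable_def by blast
qed

end

section \<open>Nanodiscs\<close>

text \<open>A fixed point or a transposition would give a smaller orbit, so only the two 3-cycles
  remain.\<close>

lemma cyclic_on_three:
  assumes "cyclic_on f {a, b, c}" "a \<noteq> b" "a \<noteq> c" "b \<noteq> c"
  shows "f a = b \<and> f b = c \<and> f c = a \<or> f a = c \<and> f c = b \<and> f b = a"
proof -
  have orb: "orbit f x = {a, b, c}" if "x \<in> {a, b, c}" for x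
    using assms(1) that unfolding cyclic_on_alldef by metis
  have closed: "f x \<in> {a, b, c}" if "x \<in> {a, b, c}" for x
    using orb[OF that] orbit.base[of f x] by metis
  have no_fix: "f x \<noteq> x" if "x \<in> {a, b, c}" for x
    using orb[OF that] assms orbit_eq_singleton_iff[of f x] by auto
  have no_swap: "\<not> (f x = y \<and> f y = x)" if "x \<in> {a, b, c}" for x y
  proof
    assume xy: "f x = y \<and> f y = x"
    have "z = x \<or> z = y" if "z \<in> orbit f x" for z
      using that by induction (use xy in auto)
    then have "{a, b, c} \<subseteq> {x, y}" using orb[OF that] by auto
    then show False using assms by auto
  qed
  show ?thesis
    using closed[of a] closed[of b] closed[of c] no_fix[of a] no_fix[of b] no_fix[of c]
      no_swap[of a b] no_swap[of a c] no_swap[of b c] assms(2-4) by auto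
qed

lemma pcas_awalk_verts: "pcas u p v \<Longrightarrow> pawalk_verts u p = u # map snd p"
  by (induction p arbitrary: u) auto

lemma pcas_nth: "pcas u p v \<Longrightarrow> j < length p \<Longrightarrow>
  snd (p ! j) = (if Suc j < length p then fst (p ! Suc j) else v)"
proof (induction p arbitrary: u j)
  case (Cons e p)
  then show ?case by (cases j; cases p) auto
qed simp

lemma pair_cycle_nth:
  fixes G :: "'a pair_pre_digraph"
  assumes "pre_digraph.cycle (with_proj G) p"
  shows "distinct (map fst p)" "distinct (map snd p)" "p \<noteq> []"
    "\<And>j. j < length p \<Longrightarrow> snd (p ! j) = fst (p ! (Suc j mod length p))"
    "fst ` set p = snd ` set p"
proof -
  obtain u where u: "pcas u p u" "distinct (tl (pawalk_verts u p))" and ne: "p \<noteq> []"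
    using assms unfolding pre_digraph.cycle_def pre_digraph.awalk_def cas_with_proj_eq
      awalk_verts_with_proj_eq by blast
  show "p \<noteq> []" by (fact ne)
  show d: "distinct (map snd p)" using u by (simp add: pcas_awalk_verts)
  have hd: "fst (p ! 0) = u" using u(1) ne by (cases p) auto
  show nth: "snd (p ! j) = fst (p ! (Suc j mod length p))" if "j < length p" for j
    using pcas_nth[OF u(1) that] hd that by (cases "Suc j = length p") auto
  \<comment> \<open>The heads of the arcs are the tails shifted by one position, so distinctness
    passes from heads to tails.\<close>
  have rot: "map snd p = rotate1 (map fst p)"
    using ne by (intro nth_equalityI) (simp_all add: nth_rotate1 nth)
  show "distinct (map fst p)" using d unfolding rot by simp
  have "set (map snd p) = set (map fst p)" unfolding rot by simp
  then show "fst ` set p = snd ` set p" by simp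
qed

section \<open>Levels, cycle neighbours and mates in a nanodisc\<close>

context fullerene_nanodisc begin

definition lev :: "'a \<Rightarrow> nat" where "lev v = (THE i. i < 2 * r \<and> v \<in> cycle_verts (C i))"
definition nx :: "'a \<Rightarrow> 'a" where "nx v = (THE w. (v, w) \<in> set (C (lev v)))"
definition pv :: "'a \<Rightarrow> 'a" where "pv v = (THE w. (w, v) \<in> set (C (lev v)))"
definition mt :: "'a \<Rightarrow> 'a" where "mt v = (THE w. (v, w) \<in> radial_arcs r G C)"

lemma lev_eqI: "i < 2 * r \<Longrightarrow> v \<in> cycle_verts (C i) \<Longrightarrow> lev v = i"
  unfolding lev_def using aux_disjoint by (intro the_equality) (blast intro: linorder_neqE_nat)+

lemma lev_cycle: "v \<in> pverts G \<Longrightarrow> lev v < 2 * r \<and> v \<in> cycle_verts (C (lev v))"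
  using aux_cover lev_eqI by (metis UN_E lessThan_iff)

lemma cycle_verts_iff: "i < 2 * r \<Longrightarrow> v \<in> cycle_verts (C i) \<longleftrightarrow> v \<in> pverts G \<and> lev v = i"
  using aux_cover lev_eqI lev_cycle by blast

lemma cycle_parcs: "i < 2 * r \<Longrightarrow> set (C i) \<subseteq> parcs G"
  using aux_separates by blast

lemma cycle_arc_lev:
  assumes "i < 2 * r" "(u, w) \<in> set (C i)"
  shows "u \<in> pverts G" "w \<in> pverts G" "lev u = i" "lev w = i" "nx u = w" "pv w = u"
proof -
  note cyc = pair_cycle_nth[OF aux_cycle[OF assms(1)]]
  have "u \<in> fst ` set (C i)" "w \<in> snd ` set (C i)" using assms(2) by force+
  then have "u \<in> cycle_verts (C i)" "w \<in> cycle_verts (C i)" unfolding cycle_verts_def cyc(5) by auto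
  then show mem: "u \<in> pverts G" "w \<in> pverts G" "lev u = i" "lev w = i"
    using cycle_verts_iff[OF assms(1)] by auto
  have inj: "inj_on fst (set (C i))" "inj_on snd (set (C i))" using cyc(1,2) by (simp_all add: distinct_map)
  show "nx u = w" unfolding nx_def mem(3)
  proof (rule the_equality)
    show "(u, w) \<in> set (C i)" by (rule assms(2))
    fix x assume "(u, x) \<in> set (C i)"
    from inj_onD[OF inj(1) _ this assms(2)] show "x = w" by simp
  qed
  show "pv w = u" unfolding pv_def mem(4)
  proof (rule the_equality)
    show "(u, w) \<in> set (C i)" by (rule assms(2))
    fix x assume "(x, w) \<in> set (C i)"
    from inj_onD[OF inj(2) _ this assms(2)] show "x = u" by simp
  qed
qed

lemma nx_arc: assumes "v \<in> pverts G" shows "(v, nx v) \<in> set (C (lev v))"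
proof -
  have "lev v < 2 * r" "v \<in> fst ` set (C (lev v))"
    using lev_cycle[OF assms] by (auto simp: cycle_verts_def)
  then obtain w where "(v, w) \<in> set (C (lev v))" by auto
  then show ?thesis using cycle_arc_lev(5)[OF \<open>lev v < 2 * r\<close>] by metis
qed

lemma pv_arc: assumes "v \<in> pverts G" shows "(pv v, v) \<in> set (C (lev v))"
proof -
  have l: "lev v < 2 * r" "v \<in> fst ` set (C (lev v))"
    using lev_cycle[OF assms] by (auto simp: cycle_verts_def)
  have "v \<in> snd ` set (C (lev v))" using l(2) unfolding pair_cycle_nth(5)[OF aux_cycle[OF l(1)]] .
  then obtain w where "(w, v) \<in> set (C (lev v))" by auto
  then show ?thesis using cycle_arc_lev(6)[OF l(1)] by metis
qed

abbreviation arc_layer :: "'a \<times> 'a \<Rightarrow> nat" where "arc_layer a \<equiv> layer (left_face rot a)"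

lemma cycle_arc_layers:
  assumes "i < 2 * r" "(u, w) \<in> set (C i)"
  shows "arc_layer (u, w) = i" "arc_layer (w, u) = i + 1"
  using assms aux_separates by auto

lemma nx_pv_props:
  assumes v: "v \<in> pverts G"
  shows "nx v \<in> pverts G" "pv v \<in> pverts G" "lev (nx v) = lev v" "lev (pv v) = lev v"
    "pv (nx v) = v" "nx (pv v) = v"
    "(v, nx v) \<in> parcs G" "(nx v, v) \<in> parcs G" "(v, pv v) \<in> parcs G" "(pv v, v) \<in> parcs G"
    "arc_layer (v, nx v) = lev v" "arc_layer (nx v, v) = lev v + 1"
    "arc_layer (pv v, v) = lev v" "arc_layer (v, pv v) = lev v + 1"
proof -
  have l: "lev v < 2 * r" using lev_cycle[OF v] by simp
  note n = nx_arc[OF v] and p = pv_arc[OF v]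
  show "nx v \<in> pverts G" "lev (nx v) = lev v" "pv (nx v) = v" using cycle_arc_lev[OF l n] by auto
  show "pv v \<in> pverts G" "lev (pv v) = lev v" "nx (pv v) = v" using cycle_arc_lev[OF l p] by auto
  show "(v, nx v) \<in> parcs G" "(pv v, v) \<in> parcs G" using n p cycle_parcs[OF l] by auto
  then show "(nx v, v) \<in> parcs G" "(v, pv v) \<in> parcs G" using arcs_symmetric by auto
  show "arc_layer (v, nx v) = lev v" "arc_layer (nx v, v) = lev v + 1"
    using cycle_arc_layers[OF l n] by auto
  show "arc_layer (pv v, v) = lev v" "arc_layer (v, pv v) = lev v + 1"
    using cycle_arc_layers[OF l p] by auto
qed

text \<open>The arcs from \<open>v\<close> to these two vertices have their left faces in the layers
  \<open>lev v\<close> and \<open>lev v + 1\<close>.\<close>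

lemma nx_ne_pv: "v \<in> pverts G \<Longrightarrow> nx v \<noteq> pv v"
  using nx_pv_props(11,14)[of v] by auto

lemma radial_sym: "(u, v) \<in> radial_arcs r G C \<Longrightarrow> (v, u) \<in> radial_arcs r G C"
  using arcs_symmetric by (auto simp: radial_arcs_def)

lemma mt_arc: "v \<in> pverts G \<Longrightarrow> (v, mt v) \<in> radial_arcs r G C"
  unfolding mt_def by (rule theI'[OF radial_perfect_matching])

lemma mt_eqI: "(v, w) \<in> radial_arcs r G C \<Longrightarrow> mt v = w"
proof -
  assume vw: "(v, w) \<in> radial_arcs r G C"
  then have "v \<in> pverts G" by (auto simp: radial_arcs_def dest: in_arcsD1)
  from radial_perfect_matching[OF this] mt_arc[OF this] vw show "mt v = w" by blast
qed

lemma mt_props: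
  assumes v: "v \<in> pverts G"
  shows "mt v \<in> pverts G" "mt (mt v) = v" "(v, mt v) \<in> parcs G" "(mt v, v) \<in> parcs G"
    "mt v \<noteq> nx v" "mt v \<noteq> pv v" "lev (mt v) = lev v + 1 \<or> lev v = lev (mt v) + 1"
proof -
  note a = mt_arc[OF v]
  show p: "(v, mt v) \<in> parcs G" "(mt v, v) \<in> parcs G"
    using a radial_sym[OF a] by (auto simp: radial_arcs_def)
  then show m: "mt v \<in> pverts G" by (auto dest: in_arcsD1)
  show "mt (mt v) = v" by (rule mt_eqI[OF radial_sym[OF a]])
  have l: "lev v < 2 * r" using lev_cycle[OF v] by simp
  show "mt v \<noteq> nx v" "mt v \<noteq> pv v"
    using a nx_arc[OF v] pv_arc[OF v] l by (auto simp: radial_arcs_def)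
  obtain i where "i + 1 < 2 * r" "v \<in> cycle_verts (C i) \<and> mt v \<in> cycle_verts (C (i + 1)) \<or>
      mt v \<in> cycle_verts (C i) \<and> v \<in> cycle_verts (C (i + 1))"
    using radial_consecutive[OF a] by blast
  then show "lev (mt v) = lev v + 1 \<or> lev v = lev (mt v) + 1"
    using cycle_verts_iff by auto
qed

section \<open>The rotation at a vertex and the layers of the faces\<close>

lemma out_arcs_eq:
  assumes v: "v \<in> pverts G"
  shows "out_arcs (with_proj G) v = {(v, pv v), (v, nx v), (v, mt v)}"
proof -
  have "card (out_arcs (with_proj G) v) = 3" using cubic[OF v] by (simp add: out_degree_def)
  moreover have "card {(v, pv v), (v, nx v), (v, mt v)} = 3"
    using nx_ne_pv[OF v] mt_props(5,6)[OF v] by auto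
  moreover have "finite (out_arcs (with_proj G) v)" by (rule finite_out_arcs)
  moreover have "{(v, pv v), (v, nx v), (v, mt v)} \<subseteq> out_arcs (with_proj G) v"
    using nx_pv_props(7,9)[OF v] mt_props(3)[OF v] by (auto simp: out_arcs_def)
  ultimately show ?thesis by (metis card_subset_eq)
qed

lemma rot_cases:
  assumes v: "v \<in> pverts G"
  shows "rot (v, pv v) = (v, nx v) \<and> rot (v, nx v) = (v, mt v) \<and> rot (v, mt v) = (v, pv v) \<or>
    rot (v, pv v) = (v, mt v) \<and> rot (v, mt v) = (v, nx v) \<and> rot (v, nx v) = (v, pv v)"
  using cyclic_on_three[of rot "(v, pv v)" "(v, nx v)" "(v, mt v)"] rotation[OF v]
    nx_ne_pv[OF v] mt_props(5,6)[OF v] unfolding out_arcs_eq[OF v] by simp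

lemma parcs_cases:
  assumes "(v, w) \<in> parcs G"
  shows "v \<in> pverts G" "w = pv v \<or> w = nx v \<or> w = mt v"
proof -
  show v: "v \<in> pverts G" by (rule in_arcsD1[OF assms])
  have "(v, w) \<in> out_arcs (with_proj G) v" using assms by (simp add: out_arcs_def)
  then show "w = pv v \<or> w = nx v \<or> w = mt v" unfolding out_arcs_eq[OF v] by simp
qed

text \<open>\<open>face_succ\<close> maps the finite set of arcs injectively to itself, so every arc
  lies on its own orbit.\<close>

lemma left_face_succ:
  assumes a: "a \<in> parcs G"
  shows "a \<in> orbit (face_succ rot) a" "left_face rot (face_succ rot a) = left_face rot a"
proof -
  have maps: "face_succ rot ` parcs G \<subseteq> parcs G"
  proof (rule image_subsetI)
    fix e assume e: "e \<in> parcs G"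
    obtain u v where uv: "e = (u, v)" by fastforce
    with e have "(v, u) \<in> parcs G" using arcs_symmetric by auto
    then have "v \<in> pverts G" "u = pv v \<or> u = nx v \<or> u = mt v" using parcs_cases by blast+
    then show "face_succ rot e \<in> parcs G"
      using rot_cases[of v] nx_pv_props(7,9)[of v] mt_props(3)[of v] by (auto simp: uv face_succ_def)
  qed
  have "inj_on (face_succ rot) (parcs G)"
  proof (rule inj_onI)
    fix e e' assume e: "e \<in> parcs G" "e' \<in> parcs G" "face_succ rot e = face_succ rot e'"
    obtain u v u' v' where uv: "e = (u, v)" "e' = (u', v')" by fastforce
    with e have "(v, u) \<in> parcs G" "(v', u') \<in> parcs G" using arcs_symmetric by auto
    then have "v \<in> pverts G" "v' \<in> pverts G" "u = pv v \<or> u = nx v \<or> u = mt v"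
      "u' = pv v' \<or> u' = nx v' \<or> u' = mt v'" using parcs_cases by blast+
    then show "e = e'"
      using e(3) rot_cases[of v] rot_cases[of v'] nx_ne_pv[of v] mt_props(5,6)[of v]
      by (auto simp: uv face_succ_def)
  qed
  with maps show self: "a \<in> orbit (face_succ rot) a"
    by (intro self_in_orbit_finite[OF pair_finite_arcs _ _ a])
  show "left_face rot (face_succ rot a) = left_face rot a"
    unfolding left_face_def by (rule self_in_orbit_step[OF self])
qed

text \<open>One of the two possible rotations at \<open>v\<close> puts both sides of the radial edge
  into the layer right of the cycle, the other into the layer left of it. Comparison with the other
  end, whose level differs by one, decides between them.\<close>

lemma radial_layer:
  assumes v: "v \<in> pverts G"
  shows "arc_layer (v, mt v) = max (lev v) (lev (mt v))"
    "lev v < lev (mt v) \<Longrightarrow> rot (v, pv v) = (v, nx v) \<and> rot (v, nx v) = (v, mt v) \<and> rot (v, mt v) = (v, pv v)"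
    "lev (mt v) < lev v \<Longrightarrow> rot (v, pv v) = (v, mt v) \<and> rot (v, mt v) = (v, nx v) \<and> rot (v, nx v) = (v, pv v)"
proof -
  let ?out = "\<lambda>v. rot (v, pv v) = (v, nx v) \<and> rot (v, nx v) = (v, mt v) \<and> rot (v, mt v) = (v, pv v)"
  let ?in = "\<lambda>v. rot (v, pv v) = (v, mt v) \<and> rot (v, mt v) = (v, nx v) \<and> rot (v, nx v) = (v, pv v)"
  have layers: "?out v \<and> arc_layer (v, mt v) = lev v + 1 \<and> arc_layer (mt v, v) = lev v + 1 \<or>
      ?in v \<and> arc_layer (v, mt v) = lev v \<and> arc_layer (mt v, v) = lev v" if v: "v \<in> pverts G" for v
  proof -
    have n: "arc_layer (rot (v, nx v)) = lev v + 1"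
      using left_face_succ(2)[OF nx_pv_props(8)[OF v]] nx_pv_props(12)[OF v] by (simp add: face_succ_def)
    have p: "arc_layer (rot (v, pv v)) = lev v"
      using left_face_succ(2)[OF nx_pv_props(10)[OF v]] nx_pv_props(13)[OF v] by (simp add: face_succ_def)
    have m: "arc_layer (rot (v, mt v)) = arc_layer (mt v, v)"
      using left_face_succ(2)[OF mt_props(4)[OF v]] by (simp add: face_succ_def)
    from rot_cases[OF v] show ?thesis
    proof (elim disjE conjE)
      assume *: "rot (v, pv v) = (v, nx v)" "rot (v, nx v) = (v, mt v)" "rot (v, mt v) = (v, pv v)"
      then have "arc_layer (v, mt v) = lev v + 1" "arc_layer (mt v, v) = lev v + 1"
        using n m nx_pv_props(14)[OF v] by metis+
      with * show ?thesis by blast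
    next
      assume *: "rot (v, pv v) = (v, mt v)" "rot (v, mt v) = (v, nx v)" "rot (v, nx v) = (v, pv v)"
      then have "arc_layer (v, mt v) = lev v" "arc_layer (mt v, v) = lev v"
        using p m nx_pv_props(11)[OF v] by metis+
      with * show ?thesis by blast
    qed
  qed
  note here = layers[OF v] and there = layers[OF mt_props(1)[OF v], unfolded mt_props(2)[OF v]]
    and lm = mt_props(7)[OF v]
  have "lev v < lev (mt v) \<and> ?out v \<and> arc_layer (v, mt v) = lev v + 1 \<or>
    lev (mt v) < lev v \<and> ?in v \<and> arc_layer (v, mt v) = lev v"
    using here
  proof (elim disjE conjE)
    assume *: "arc_layer (v, mt v) = lev v + 1" "rot (v, pv v) = (v, nx v)"
      "rot (v, nx v) = (v, mt v)" "rot (v, mt v) = (v, pv v)"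
    have "lev v < lev (mt v)" using there lm *(1) by linarith
    with * show ?thesis by blast
  next
    assume *: "arc_layer (v, mt v) = lev v" "rot (v, pv v) = (v, mt v)"
      "rot (v, mt v) = (v, nx v)" "rot (v, nx v) = (v, pv v)"
    have "lev (mt v) < lev v" using there lm *(1) by linarith
    with * show ?thesis by blast
  qed
  then show "arc_layer (v, mt v) = max (lev v) (lev (mt v))" "lev v < lev (mt v) \<Longrightarrow> ?out v"
    "lev (mt v) < lev v \<Longrightarrow> ?in v"
    using lm by auto
qed

lemma ring_map: "ring_map (pverts G) nx pv mt lev (face_succ rot) r"
proof
  fix v assume v: "v \<in> pverts G"
  show "nx v \<in> pverts G" "pv v \<in> pverts G" "nx (pv v) = v" "pv (nx v) = v"
    "lev (nx v) = lev v" "lev (pv v) = lev v" using nx_pv_props[OF v] by auto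
  show "mt v \<in> pverts G" "mt (mt v) = v" "lev (mt v) = lev v + 1 \<or> lev v = lev (mt v) + 1"
    using mt_props[OF v] by auto
  show "lev v < 2 * r" using lev_cycle[OF v] by simp
  show "face_succ rot (mt v, v) = (v, nx v) \<and> face_succ rot (pv v, v) = (v, mt v) \<and>
      face_succ rot (nx v, v) = (v, pv v)" if "lev (mt v) < lev v"
    using radial_layer(3)[OF v that] by (simp add: face_succ_def)
  show "face_succ rot (mt v, v) = (v, pv v) \<and> face_succ rot (pv v, v) = (v, nx v) \<and>
      face_succ rot (nx v, v) = (v, mt v)" if "lev v < lev (mt v)"
    using radial_layer(2)[OF v that] by (simp add: face_succ_def)
  let ?e = "(v, mt v)" and ?F = "face_succ rot"
  \<comment> \<open>\<open>N\<close> is the size of the face left of the radial arc. By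
    \<open>radial_layer\<close> the maximum of the two levels is the layer of that face, so
    \<open>N\<close> is 6 off the central layer.\<close>
  define N where "N = funpow_dist1 ?F ?e ?e"
  have e: "?e \<in> parcs G" by (rule mt_props(3)[OF v])
  note self = left_face_succ(1)[OF e]
  have face: "left_face rot ?e \<in> faces G rot" using e by (auto simp: faces_def)
  have "card (left_face rot ?e) = N"
    unfolding left_face_def orbit_conv_funpow_dist1[OF self] N_def
    by (subst card_image[OF inj_on_funpow_dist1[OF self]]) simp
  then have "N = 5 \<or> N = 6" "max (lev v) (lev (mt v)) \<noteq> r \<Longrightarrow> N = 6"
    using face_size[OF face] pentagons_central[OF face] radial_layer(1)[OF v] by auto
  moreover have "(?F ^^ N) ?e = ?e" unfolding N_def by (rule funpow_dist1_prop[OF self])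
  moreover have "\<forall>j. 0 < j \<and> j < N \<longrightarrow> (?F ^^ j) ?e \<noteq> ?e"
    unfolding N_def by (intro allI impI funpow_dist1_least) auto
  ultimately show "\<exists>N\<in>{5, 6}. (?F ^^ N) ?e = ?e \<and> (\<forall>j. 0 < j \<and> j < N \<longrightarrow> (?F ^^ j) ?e \<noteq> ?e) \<and>
      (max (lev v) (lev (mt v)) \<noteq> r \<longrightarrow> N = 6)" by blast
qed

section \<open>The cycles and the edges of the central layer\<close>

lemma nx_funpow_reaches:
  assumes "i < 2 * r" "u \<in> cycle_verts (C i)" "v \<in> cycle_verts (C i)"
  shows "\<exists>n. v = (nx ^^ n) u"
proof -
  note cyc = pair_cycle_nth[OF aux_cycle[OF assms(1)]]
  let ?L = "length (C i)"
  have step: "nx (fst (C i ! j)) = fst (C i ! (Suc j mod ?L))" if "j < ?L" for j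
  proof -
    have "(fst (C i ! j), snd (C i ! j)) \<in> set (C i)" using that by simp
    from cycle_arc_lev(5)[OF assms(1) this] show ?thesis using cyc(4)[OF that] by simp
  qed
  have index: "\<exists>j<?L. w = fst (C i ! j)" if "w \<in> cycle_verts (C i)" for w
    using that unfolding cycle_verts_def image_iff by (metis in_set_conv_nth)
  obtain j k where jk: "j < ?L" "u = fst (C i ! j)" "k < ?L" "v = fst (C i ! k)"
    using index[OF assms(2)] index[OF assms(3)] by blast
  have "(nx ^^ n) u = fst (C i ! ((j + n) mod ?L))" for n
  proof (induction n)
    case 0
    then show ?case using jk by simp
  next
    case (Suc n)
    then show ?case using step[of "(j + n) mod ?L"] cyc(3) by (simp add: mod_Suc_eq)
  qed
  \<comment> \<open>From position \<open>j\<close>, \<open>?L - j\<close> steps lead around to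
    position 0 and \<open>k\<close> more to \<open>v\<close>.\<close>
  moreover have "(j + (?L - j + k)) mod ?L = k" using jk by simp
  ultimately show ?thesis using jk(4) by metis
qed

lemma card_cycle_verts: "i < 2 * r \<Longrightarrow> card (cycle_verts (C i)) = length (C i)"
  unfolding cycle_verts_def using pair_cycle_nth(1)[OF aux_cycle, of i]
  by (metis distinct_card length_map list.set_map)

lemma total_colorable_central_layer: "total_colorable 4 (central_layer r G C)"
proof -
  interpret R: ring_map "pverts G" nx pv mt lev "face_succ rot" r by (rule ring_map)
  have lt: "r - 1 < 2 * r" "r < 2 * r" using radius by auto
  have pred: "x = r - 1 \<longleftrightarrow> x + 1 = r" for x using radius by arith
  have inner: "cycle_verts (C (r - 1)) = {v \<in> pverts G. lev v + 1 = r}"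
    unfolding set_eq_iff cycle_verts_iff[OF lt(1)] pred by simp
  have outer: "cycle_verts (C r) = {v \<in> pverts G. lev v = r}"
    unfolding set_eq_iff cycle_verts_iff[OF lt(2)] by simp
  \<comment> \<open>The minimum in the length formula is \<open>min r (r + 1)\<close> at index
    \<open>r - 1\<close> and \<open>min (r + 1) r\<close> at index \<open>r\<close>, so it is
    \<open>r\<close> for both cycles.\<close>
  have lens: "length (C (r - 1)) = 12 * r - 6" "length (C r) = 12 * r - 6"
    using aux_length[OF lt(1)] aux_length[OF lt(2)] radius by (simp_all add: min_def)
  have card_eq: "card {v \<in> pverts G. lev v + 1 = r} = card {v \<in> pverts G. lev v = r}"
    using card_cycle_verts[OF lt(1)] card_cycle_verts[OF lt(2)] lens unfolding inner outer by simp
  have "C (r - 1) \<noteq> []" by (rule pair_cycle_nth(3)[OF aux_cycle[OF lt(1)]])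
  then have "cycle_verts (C (r - 1)) \<noteq> {}" by (simp add: cycle_verts_def)
  then obtain a where a: "a \<in> pverts G" "lev a + 1 = r" using inner by auto
  have verts: "pverts (central_layer r G C) = R.central"
    unfolding central_layer_def Let_def inner outer R.central_def by auto
  have parcs: "parcs (central_layer r G C) = set (C (r - 1)) \<union> (set (C (r - 1)))\<inverse> \<union> set (C r) \<union>
      (set (C r))\<inverse> \<union> radial_arcs r G C \<inter> ({v \<in> pverts G. lev v + 1 = r} \<times> {v \<in> pverts G. lev v = r} \<union>
        {v \<in> pverts G. lev v = r} \<times> {v \<in> pverts G. lev v + 1 = r})"
    unfolding central_layer_def Let_def inner outer by simp
  have cyc: "u \<in> R.central \<and> w = nx u" if "(u, w) \<in> set (C (r - 1)) \<or> (u, w) \<in> set (C r)" for u w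
    using that cycle_arc_lev[OF lt(1), of u w] cycle_arc_lev[OF lt(2), of u w]
    unfolding pred R.central_def mem_Collect_eq by metis
  have edges: "edges (central_layer r G C) =
      (\<lambda>v. {v, nx v}) ` R.central \<union> (\<lambda>v. {v, mt v}) ` {v. R.on_ring v}"
  proof
    show "edges (central_layer r G C) \<subseteq> (\<lambda>v. {v, nx v}) ` R.central \<union> (\<lambda>v. {v, mt v}) ` {v. R.on_ring v}"
    proof
      fix e assume "e \<in> edges (central_layer r G C)"
      then obtain u w where e: "e = {u, w}" and uw: "(u, w) \<in> parcs (central_layer r G C)"
        by (auto simp: edges_def)
      from uw consider "(u, w) \<in> set (C (r - 1)) \<or> (u, w) \<in> set (C r)"
        | "(w, u) \<in> set (C (r - 1)) \<or> (w, u) \<in> set (C r)"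
        | "(u, w) \<in> radial_arcs r G C" "u \<in> pverts G"
          "lev u + 1 = r \<and> lev w = r \<or> lev u = r \<and> lev w + 1 = r"
        unfolding parcs by blast
      then show "e \<in> (\<lambda>v. {v, nx v}) ` R.central \<union> (\<lambda>v. {v, mt v}) ` {v. R.on_ring v}"
      proof cases
        case 1
        then show ?thesis using cyc e by blast
      next
        case 2
        then have "w \<in> R.central" "u = nx w" using cyc by blast+
        then have "e = {w, nx w}" using e by (simp add: insert_commute)
        then show ?thesis using \<open>w \<in> R.central\<close> by blast
      next
        case 3
        then have "mt u = w" by (intro mt_eqI)
        then have "R.on_ring u" using 3 by (auto simp: R.on_ring_def R.inward_def)
        then show ?thesis using \<open>mt u = w\<close> e by blast
      qed
    qed
    have "{v, nx v} \<in> edges (central_layer r G C)" if "v \<in> R.central" for v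
    proof -
      have "v \<in> pverts G" "lev v = r - 1 \<or> lev v = r"
        using that unfolding pred R.central_def mem_Collect_eq by blast+
      then have "(v, nx v) \<in> parcs (central_layer r G C)" using nx_arc[of v] by (auto simp: parcs)
      then show ?thesis by (force simp: edges_def)
    qed
    moreover have "{v, mt v} \<in> edges (central_layer r G C)" if "R.on_ring v" for v
    proof -
      have "v \<in> pverts G" "lev v + 1 = r \<and> lev (mt v) = r \<or> lev v = r \<and> lev (mt v) + 1 = r"
        using that mt_props(7)[of v] by (auto simp: R.on_ring_def R.inward_def)
      then have "(v, mt v) \<in> parcs (central_layer r G C)"
        using mt_arc[of v] mt_props(1)[of v] by (auto simp: parcs)
      then show ?thesis by (force simp: edges_def)
    qed
    ultimately show "(\<lambda>v. {v, nx v}) ` R.central \<union> (\<lambda>v. {v, mt v}) ` {v. R.on_ring v}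
        \<subseteq> edges (central_layer r G C)" by auto
  qed
  show ?thesis
  proof (rule R.total_colorable_central[OF pair_finite_verts _ card_eq a _ verts edges])
    show "\<exists>n. v = (nx ^^ n) u" if "u \<in> pverts G" "v \<in> pverts G" "lev u + 1 = r" "lev v + 1 = r" for u v
      using that inner by (intro nx_funpow_reaches[OF lt(1)]) auto
    show "nx (nx v) \<noteq> v" if "v \<in> pverts G" for v
      using nx_ne_pv[OF nx_pv_props(1)[OF that]] nx_pv_props(5)[OF that] by auto
  qed
qed

end

theorem lemma4:
  fixes r :: nat and G :: "'a pair_pre_digraph" and rot :: "'a \<times> 'a \<Rightarrow> 'a \<times> 'a"
    and layer :: "('a \<times> 'a) set \<Rightarrow> nat" and C :: "nat \<Rightarrow> ('a \<times> 'a) list"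
  assumes "2 \<le> r"
    and "fullerene_nanodisc r G rot layer C"
  shows "total_colorable 4 (central_layer r G C)"
  by (rule fullerene_nanodisc.total_colorable_central_layer[OF assms(2)])

end
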